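(* Let $0<q<1$ and let $C:[0,\pi]\to\mathbb{R}$ be the function $$C(\theta)=\frac{2}{c_2}\int_0^\pi\left(\pi^q\lambda^{-q}-1\right)\sin\lambda\int_{A(\lambda)}\left(\pi^q a(\theta,\lambda,\phi)^{-q}-1\right)d\phi\,d\lambda,\qquad 0\le\theta\le\pi,$$ which is the correlation function associated with the power kernel $k(\theta)=(\theta/\pi)^{-q}-1$, $0<\theta\le\pi$. Then $$\lim_{\theta\downarrow0}\frac{C(0)-C(\theta)}{\theta^{2-2q}}=b_q,$$ where $$b_q=\frac{2\pi^{2q}}{c_2}\int_0^\infty x^{1-q}\int_0^\pi\left(x^{-q}-\left(x^2+1-2x\cos\phi\right)^{-q/2}\right)d\phi\,dx=\frac{\pi^{2q+1}}{c_2(1-q)^2}\,\frac{\Gamma(1-\tfrac12q)^2\,\Gamma(q)}{\Gamma(\tfrac12q)^2\,\Gamma(1-q)}.$$ In particular, the correlation function $C$ has fractal index $\alpha=2-2q$.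
   Context: Here $$t(\theta,\lambda,\phi)=\sin\theta\sin\lambda\cos\phi+\cos\theta\cos\lambda,\qquad a(\theta,\lambda,\phi)=\arccos t(\theta,\lambda,\phi),$$ $$A(\lambda)=\{\phi\in[0,\pi]:0<a(\theta,\lambda,\phi)\le\pi\},\qquad c_2=2\pi\int_0^\pi(\pi^q\lambda^{-q}-1)^2\sin\lambda\,d\lambda.$$ A correlation function $C:[0,\pi]\to\mathbb{R}$ has fractal index $\alpha>0$ if there is a constant $b>0$ such that $\lim_{\theta\downarrow0}(C(0)-C(\theta))/\theta^\alpha=b$. $\Gamma$ is the Gamma function. *)

theory Defs
  imports "HOL-Analysis.Analysis"
begin

definition sph_t :: "real \<Rightarrow> real \<Rightarrow> real \<Rightarrow> real" where
  "sph_t \<theta> l \<phi> = sin \<theta> * sin l * cos \<phi> + cos \<theta> * cos l"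

definition sph_a :: "real \<Rightarrow> real \<Rightarrow> real \<Rightarrow> real" where
  "sph_a \<theta> l \<phi> = arccos (sph_t \<theta> l \<phi>)"

(* The set A(lambda), with l for lambda; it also depends on \<theta>, which the usual notation suppresses. *)
definition sph_A :: "real \<Rightarrow> real \<Rightarrow> real set" where
  "sph_A \<theta> l = {\<phi> \<in> {0..pi}. 0 < sph_a \<theta> l \<phi> \<and> sph_a \<theta> l \<phi> \<le> pi}"

(* All integrals below are (iterated) Lebesgue integrals. At l = 0, where l^(-q) is
   undefined, the library has 0 powr (-q) = 0; this only concerns null sets. *)

definition c2 :: "real \<Rightarrow> real" where
  "c2 q = 2 * pi * (LBINT l:{0..pi}. ((pi powr q * l powr (- q) - 1)\<^sup>2 * sin l))"

(* The double integral must be read as iterated: for q \<le> 1/2 the integrand is not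
   absolutely integrable in (\<phi>, x) jointly. *)
definition b_const :: "real \<Rightarrow> real" where
  "b_const q = 2 * pi powr (2 * q) / c2 q *
     (LBINT x:{0..}. x powr (1 - q) *
       (LBINT \<phi>:{0..pi}. (x powr (- q) - (x\<^sup>2 + 1 - 2 * x * cos \<phi>) powr (- q / 2))))"

(* Only the values of C on [0, pi] are relevant. *)
definition has_fractal_index :: "(real \<Rightarrow> real) \<Rightarrow> real \<Rightarrow> bool" where
  "has_fractal_index C \<alpha> \<longleftrightarrow> \<alpha> > 0 \<and>
     (\<exists>b>0. ((\<lambda>\<theta>. (C 0 - C \<theta>) / \<theta> powr \<alpha>) \<longlongrightarrow> b) (at_right 0))"

end

theory Submission
  imports Defs "HOL-Probability.Distributions" "HOL-Real_Asymp.Real_Asymp"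
begin

text \<open>
  Up to the factor \<open>2 \<pi>\<^sup>2\<^sup>q / c\<^sub>2\<close>, the difference \<open>C(0) - C(\<theta>)\<close> is the integral over \<open>l\<close> of
  \<open>(l\<^sup>-\<^sup>q - \<pi>\<^sup>-\<^sup>q) sin l H(\<theta>, l)\<close> with \<open>H(\<theta>, l) = \<integral> (l\<^sup>-\<^sup>q - a\<^sup>-\<^sup>q) d\<phi>\<close>. The substitution \<open>l = \<theta> x\<close>
  extracts \<open>\<theta>\<^sup>2\<^sup>-\<^sup>2\<^sup>q\<close>, and dominated convergence yields the planar integral in \<open>b\<^sub>q\<close>. For \<open>x \<ge> 2\<close> the
  dominating function comes from the second-order cancellation
  \<open>H(\<theta>, l) sin l = O(\<theta>\<^sup>2 l\<^sup>-\<^sup>q\<^sup>-\<^sup>1)\<close>, for \<open>x \<le> 2\<close> from \<open>a \<ge> sin \<theta> sin \<phi>\<close>.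

  The planar integral is evaluated by writing both powers as Gamma integrals of Gaussians. Integrating
  out \<open>x\<close> and \<open>\<phi>\<close> leaves the double integral over \<open>s, t > 0\<close> of
  \<open>(s t)\<^sup>q\<^sup>/\<^sup>2\<^sup>-\<^sup>1 (1 - exp (- s t / (s + t))) / (s + t)\<close>, whose integrand is nonnegative. In
  the variables \<open>s\<close> and \<open>v = t / s\<close> it is a Gamma integral in \<open>s\<close> followed by a Beta integral in \<open>v\<close>.
\<close>

subsection \<open>Auxiliary integrals and Taylor estimates\<close>

text \<open>The first-order bound \<open>\<bar>a - l\<bar> \<le> \<theta>\<close> only gives
  \<open>H(\<theta>, l) sin l = O(\<theta> l^(-q))\<close>, which scales to a tail of order
  \<open>x powr (- 2 * q)\<close>, integrable only for \<open>q > 1/2\<close>. One more order is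
  available because \<open>a - l\<close> is close to \<open>- \<theta> cos \<phi>\<close>, whose
  mean over \<open>{0..pi}\<close> is zero. Hence the angle must be integrated before absolute
  values are taken.

  The same obstacle returns in the plane. The inner integral \<open>plane_H\<close> is positive near
  0 and negative beyond 1, so Tonelli does not apply to the integral over \<open>x\<close> directly.
  Dominated convergence yields the integrability of \<open>x powr (1 - q) * plane_H q x\<close> as a
  by-product, and this justifies exchanging \<open>x\<close> with the Gamma variable
  \<open>s\<close>. For fixed \<open>s\<close> the weight \<open>exp (- (s * x^2))\<close> makes the
  two terms of \<open>plane_H\<close> separately integrable against \<open>x\<close>, so they are
  computed as nonnegative integrals and then subtracted.\<close>

lemma abs_LBINT_Icc_le:
  fixes f :: "real \<Rightarrow> real"
  assumes "a \<le> b" "set_integrable lborel {a..b} f" "\<And>x. x \<in> {a..b} \<Longrightarrow> \<bar>f x\<bar> \<le> B"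
  shows "\<bar>LBINT x:{a..b}. f x\<bar> \<le> (b - a) * B"
proof -
  have "\<bar>LBINT x:{a..b}. f x\<bar> \<le> (LBINT x:{a..b}. \<bar>f x\<bar>)"
    using set_integral_norm_bound[OF assms(2)] by simp
  also have "\<dots> \<le> (LBINT x:{a..b}. B)"
    using set_integrable_norm[OF assms(2)] assms(3)
    by (intro set_integral_mono) (auto intro!: borel_integrable_atLeastAtMost' continuous_intros)
  also have "\<dots> = (b - a) * B" using assms(1) by (simp add: set_lebesgue_integral_def)
  finally show ?thesis .
qed

text \<open>For a nonnegative Borel function the gauge integral and the Lebesgue integral have the
  same value, so closed forms of the former yield integrability.\<close>

lemma set_integrable_of_has_integral:
  fixes f :: "real \<Rightarrow> real"
  assumes "f \<in> borel_measurable borel" "S \<in> sets borel" "\<And>x. 0 \<le> f x" "(f has_integral I) S"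
  shows "set_integrable lborel S f"
  unfolding set_integrable_def real_scaleR_def
proof (rule integrableI_nonneg)
  have "(\<integral>\<^sup>+x. ennreal (indicator S x * f x) \<partial>lborel) = ennreal I"
    using nn_integral_has_integral_lebesgue[OF assms(3,4)] by (simp add: mult.commute)
  then show "(\<integral>\<^sup>+x. ennreal (indicator S x * f x) \<partial>lborel) < \<infinity>" by simp
qed (use assms in \<open>auto simp: indicator_def\<close>)

lemma set_integrable_powr_Icc_0:
  fixes p b :: real
  assumes "- 1 < p" "0 \<le> b"
  shows "set_integrable lborel {0..b} (\<lambda>x. x powr p)"
  using has_integral_powr_from_0[of p b] assms by (intro set_integrable_of_has_integral) auto

text \<open>A weak Jordan inequality, with 1/4 in place of 2/pi. Up to pi/3 the difference increases
  because the cosine is at least 1/2; beyond pi/3 the sine is at least 1/2 while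
  \<open>y / 4\<close> is below 1/2. This constant is the source of every \<open>4 powr q\<close>
  below.\<close>

lemma sin_ge_quarter: "y / 4 \<le> sin y" if "0 \<le> y" "y \<le> pi / 2" for y :: real
proof (cases "y \<le> pi / 3")
  case True
  have "sin 0 - 0 / 4 \<le> sin y - y / 4"
  proof (rule DERIV_nonneg_imp_nondecreasing[OF that(1)])
    fix x assume x: "0 \<le> x" "x \<le> y"
    have "cos (pi / 3) \<le> cos x" using x True pi_gt_zero by (intro cos_monotone_0_pi_le) linarith+
    then show "\<exists>d. ((\<lambda>x. sin x - x / 4) has_real_derivative d) (at x) \<and> 0 \<le> d"
      by (intro exI[of _ "cos x - 1 / 4"]) (auto intro!: derivative_eq_intros simp: cos_60)
  qed
  then show ?thesis by simp
next
  case False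
  have "sin (pi / 6) \<le> sin y" using False that pi_gt_zero by (intro sin_monotone_2pi_le) linarith+
  then show ?thesis using that pi_less_4 unfolding sin_30 by linarith
qed

text \<open>Both endpoint singularities have order \<open>- q\<close>, which is integrable since
  \<open>q < 1\<close>. The value of the integral enters the dominating function as a
  constant.\<close>

lemma set_integrable_sin_powr:
  assumes "0 < q" "q < 1"
  shows "set_integrable lborel {0..pi} (\<lambda>\<phi>. sin \<phi> powr (- q))"
proof -
  have i1: "integrable lborel (\<lambda>\<phi>. indicator {0..pi} \<phi> * \<phi> powr (- q))"
    using set_integrable_powr_Icc_0[of "- q" pi] assms by (simp add: set_integrable_def)
  \<comment> \<open>The reflection of the interval moves the singularity from 0 to pi.\<close>
  then have "integrable lborel (\<lambda>\<phi>. indicator {0..pi} (pi + (-1) * \<phi>) * (pi + (-1) * \<phi>) powr (- q))"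
    by (subst lborel_integrable_real_affine_iff[of "-1" _ pi]) auto
  also have "(\<lambda>\<phi>. indicator {0..pi} (pi + (-1) * \<phi>) * (pi + (-1) * \<phi>) powr (- q)) = (\<lambda>\<phi>. indicator {0..pi} \<phi> * (pi - \<phi>) powr (- q))"
    by (auto simp: fun_eq_iff indicator_def)
  finally have i2: "integrable lborel (\<lambda>\<phi>. indicator {0..pi} \<phi> * (pi - \<phi>) powr (- q))" .
  have *: "sin \<phi> powr (- q) \<le> 4 powr q * (\<phi> powr (- q) + (pi - \<phi>) powr (- q))" if "0 < \<phi>" "\<phi> < pi" for \<phi>
  proof -
    have b: "sin \<phi> powr (- q) \<le> 4 powr q * y powr (- q)" if "0 < y" "y / 4 \<le> sin \<phi>" for y
    proof -
      have "sin \<phi> powr (- q) \<le> (y / 4) powr (- q)" using that assms by (intro powr_mono2') auto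
      also have "\<dots> = 4 powr q * y powr (- q)" using powr_minus_divide[of "4::real" q] by (simp add: powr_divide)
      finally show ?thesis .
    qed
    show ?thesis
    proof (cases "\<phi> \<le> pi / 2")
      case True
      then have "sin \<phi> powr (- q) \<le> 4 powr q * \<phi> powr (- q)" using that by (intro b sin_ge_quarter) auto
      also have "\<dots> \<le> 4 powr q * (\<phi> powr (- q) + (pi - \<phi>) powr (- q))" by (intro mult_left_mono) auto
      finally show ?thesis .
    next
      case False
      have "(pi - \<phi>) / 4 \<le> sin (pi - \<phi>)" using that False by (intro sin_ge_quarter) auto
      then have "sin \<phi> powr (- q) \<le> 4 powr q * (pi - \<phi>) powr (- q)" using that by (intro b) auto
      also have "\<dots> \<le> 4 powr q * (\<phi> powr (- q) + (pi - \<phi>) powr (- q))" by (intro mult_left_mono) auto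
      finally show ?thesis .
    qed
  qed
  show ?thesis
    unfolding set_integrable_def
  proof (rule Bochner_Integration.integrable_bound)
    show "integrable lborel (\<lambda>\<phi>. 4 powr q * (indicator {0..pi} \<phi> * \<phi> powr (- q) + indicator {0..pi} \<phi> * (pi - \<phi>) powr (- q)))"
      using i1 i2 by auto
    show "AE \<phi> in lborel. norm (indicator {0..pi} \<phi> *\<^sub>R sin \<phi> powr (- q)) \<le> norm (4 powr q * (indicator {0..pi} \<phi> * \<phi> powr (- q) + indicator {0..pi} \<phi> * (pi - \<phi>) powr (- q)))"
    proof (rule AE_I2)
      fix \<phi> :: real
      \<comment> \<open>At the endpoints the sine vanishes and \<open>0 powr (- q)\<close> is 0, so
        the bound is trivial there.\<close>
      consider "0 < \<phi>" "\<phi> < pi" | "\<phi> = 0 \<or> \<phi> = pi" | "\<phi> \<notin> {0..pi}" by fastforce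
      then show "norm (indicator {0..pi} \<phi> *\<^sub>R sin \<phi> powr (- q)) \<le> norm (4 powr q * (indicator {0..pi} \<phi> * \<phi> powr (- q) + indicator {0..pi} \<phi> * (pi - \<phi>) powr (- q)))"
        by cases (use * in \<open>auto simp: indicator_def\<close>)
    qed
  qed simp
qed

lemma taylor_second_order:
  fixes f f' f'' :: "real \<Rightarrow> real"
  assumes "\<And>t. min x y \<le> t \<Longrightarrow> t \<le> max x y \<Longrightarrow> (f has_real_derivative f' t) (at t)"
    and "\<And>t. min x y \<le> t \<Longrightarrow> t \<le> max x y \<Longrightarrow> (f' has_real_derivative f'' t) (at t)"
    and bound: "\<And>t. min x y \<le> t \<Longrightarrow> t \<le> max x y \<Longrightarrow> \<bar>f'' t\<bar> \<le> B"
  shows "\<bar>f y - f x - f' x * (y - x)\<bar> \<le> B / 2 * (y - x)\<^sup>2"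
proof (cases "x = y")
  case False
  define diff where "diff m = (if m = 0 then f else if m = 1 then f' else f'')" for m :: nat
  have "\<exists>t. (if y < x then y < t \<and> t < x else x < t \<and> t < y) \<and>
    f y = (\<Sum>m<2. (diff m x / fact m) * (y - x)^m) + (diff 2 t / fact 2) * (y - x)^2"
    using False assms(1,2) by (intro Taylor[where a = "min x y" and b = "max x y"])
      (auto simp: diff_def less_2_cases_iff)
  then obtain t where t0: "if y < x then y < t \<and> t < x else x < t \<and> t < y"
    "f y = (\<Sum>m<2. (diff m x / fact m) * (y - x)^m) + (diff 2 t / fact 2) * (y - x)^2"
    by blast
  have t: "min x y \<le> t" "t \<le> max x y" using t0(1) by (auto split: if_splits)
  have ft: "f y = f x + f' x * (y - x) + f'' t / 2 * (y - x)\<^sup>2"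
    using t0(2) by (simp add: diff_def numeral_2_eq_2)
  have "\<bar>f y - f x - f' x * (y - x)\<bar> = \<bar>f'' t\<bar> / 2 * (y - x)\<^sup>2"
    using ft by (simp add: abs_mult)
  also have "\<dots> \<le> B / 2 * (y - x)\<^sup>2"
    using bound[OF t] by (intro mult_right_mono divide_right_mono) auto
  finally show ?thesis .
qed simp

lemma cos_second_order: "\<bar>cos y - cos x + sin x * (y - x)\<bar> \<le> (y - x)\<^sup>2 / 2" for x y :: real
proof -
  have "\<bar>cos y - cos x - (- sin x) * (y - x)\<bar> \<le> 1 / 2 * (y - x)\<^sup>2"
    by (rule taylor_second_order[where f'' = "\<lambda>t. - cos t"]) (auto intro!: derivative_eq_intros)
  then show ?thesis by simp
qed

text \<open>The hypothesis \<open>x / 2 \<le> y\<close> keeps the whole segment between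
  \<open>x\<close> and \<open>y\<close> to the right of \<open>x / 2\<close>, where the decreasing
  second derivative is at most its value at \<open>x / 2\<close>.\<close>

lemma powr_second_order:
  fixes q x y :: real
  assumes "0 < q" "0 < x" "x / 2 \<le> y"
  shows "\<bar>y powr (- q) - x powr (- q) + q * x powr (- q - 1) * (y - x)\<bar>
     \<le> q * (q + 1) / 2 * (x / 2) powr (- q - 2) * (y - x)\<^sup>2"
proof -
  have "\<bar>y powr (- q) - x powr (- q) - (- q * x powr (- q - 1)) * (y - x)\<bar>
     \<le> (q * (q + 1) * (x / 2) powr (- q - 2)) / 2 * (y - x)\<^sup>2"
  proof (rule taylor_second_order[where f'' = "\<lambda>t. q * (q + 1) * t powr (- q - 2)"])
    fix t assume "min x y \<le> t" "t \<le> max x y"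
    then have t: "x / 2 \<le> t" "0 < t" using assms by (auto simp: min_def split: if_splits)
    show "((\<lambda>t. t powr (- q)) has_real_derivative - q * t powr (- q - 1)) (at t)"
      using t by (auto intro!: derivative_eq_intros)
    show "((\<lambda>t. - q * t powr (- q - 1)) has_real_derivative q * (q + 1) * t powr (- q - 2)) (at t)"
      using t by (auto intro!: derivative_eq_intros simp: algebra_simps)
    show "\<bar>q * (q + 1) * t powr (- q - 2)\<bar> \<le> q * (q + 1) * (x / 2) powr (- q - 2)"
      using t assms by (auto simp: abs_mult intro!: mult_left_mono powr_mono2')
  qed
  then show ?thesis by simp
qed

subsection \<open>Gaussian integrals in the plane\<close>

lemma LBINT_cos_0_pi: "(LBINT \<phi>:{0..pi}. cos \<phi>) = 0"
  using integral_FTC_Icc_real[of 0 pi sin cos]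
  by (auto simp: set_lebesgue_integral_def has_real_derivative_iff_has_vector_derivative[symmetric] mult.commute intro!: derivative_eq_intros)

text \<open>Rescaling of the Gamma integral. Read from right to left it writes
  \<open>c powr (- p)\<close> as a superposition of exponentials, which are Gaussians when
  \<open>c\<close> is a squared distance.\<close>

lemma nn_integral_powr_exp:
  fixes p c :: real
  assumes "0 < p" "0 < c"
  shows "(\<integral>\<^sup>+t. ennreal (indicator {0<..} t * (t powr (p - 1) * exp (- (c * t)))) \<partial>lborel)
    = ennreal (Gamma p * c powr (- p))"
proof -
  have "ennreal (Gamma p) = (\<integral>\<^sup>+t. ennreal (indicator {0..} t * t powr (p - 1) / exp t) \<partial>lborel)"
    using assms(1) by (rule Gamma_conv_nn_integral_real)
  also have "\<dots> = ennreal c * (\<integral>\<^sup>+t. ennreal (indicator {0..} (c * t) * (c * t) powr (p - 1) / exp (c * t)) \<partial>lborel)"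
    using assms by (subst nn_integral_real_affine[where c = c and t = 0]) auto
  also have "\<dots> = (\<integral>\<^sup>+t. ennreal (c powr p) * ennreal (indicator {0<..} t * (t powr (p - 1) * exp (- (c * t)))) \<partial>lborel)"
    using assms by (subst nn_integral_cmult[symmetric])
     (auto intro!: nn_integral_cong_AE AE_I2 simp: indicator_def zero_le_mult_iff powr_mult exp_minus divide_inverse powr_diff mult_ac simp flip: ennreal_mult')
  also have "\<dots> = ennreal (c powr p) * (\<integral>\<^sup>+t. ennreal (indicator {0<..} t * (t powr (p - 1) * exp (- (c * t)))) \<partial>lborel)"
    by (rule nn_integral_cmult) simp
  finally have "ennreal (c powr (-p)) * ennreal (Gamma p) = (ennreal (c powr (-p)) * ennreal (c powr p)) * (\<integral>\<^sup>+t. ennreal (indicator {0<..} t * (t powr (p - 1) * exp (- (c * t)))) \<partial>lborel)"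
    by (simp only: mult.assoc)
  then show ?thesis using assms by (simp add: mult.commute flip: ennreal_mult' powr_add)
qed

text \<open>Wallis recursion: \<open>sin \<phi> * cos \<phi> ^ Suc n\<close> vanishes at 0 and pi,
  so its derivative has integral zero.\<close>

lemma LBINT_cos_power_Suc_Suc:
  "(LBINT \<phi>:{0..pi}. cos \<phi> ^ Suc (Suc n)) = real (Suc n) / real (Suc (Suc n)) * (LBINT \<phi>:{0..pi}. cos \<phi> ^ n)"
proof -
  have i: "set_integrable lborel {0..pi} (\<lambda>\<phi>. c * cos \<phi> ^ m)" for c :: real and m
    by (intro borel_integrable_atLeastAtMost' continuous_intros)
  have "(LBINT \<phi>:{0..pi}. real (Suc (Suc n)) * cos \<phi> ^ Suc (Suc n) - real (Suc n) * cos \<phi> ^ n) = 0"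
  proof -
    have "((\<lambda>\<phi>. sin \<phi> * cos \<phi> ^ Suc n) has_real_derivative real (Suc (Suc n)) * cos \<phi> ^ Suc (Suc n) - real (Suc n) * cos \<phi> ^ n) (at \<phi>)" for \<phi>
    proof -
      have s: "sin \<phi> * sin \<phi> = 1 - cos \<phi> * cos \<phi>" by (simp add: sin_squared_eq flip: power2_eq_square)
      have "((\<lambda>\<phi>. sin \<phi> * cos \<phi> ^ Suc n) has_real_derivative (cos \<phi> * cos \<phi> ^ Suc n - real (Suc n) * cos \<phi> ^ n * (sin \<phi> * sin \<phi>))) (at \<phi>)"
        by (auto intro!: derivative_eq_intros simp: algebra_simps simp del: power_Suc)
      then show ?thesis unfolding s by (simp add: algebra_simps)
    qed
    then show ?thesis
      using integral_FTC_Icc_real[of 0 pi "\<lambda>\<phi>. sin \<phi> * cos \<phi> ^ Suc n" "\<lambda>\<phi>. real (Suc (Suc n)) * cos \<phi> ^ Suc (Suc n) - real (Suc n) * cos \<phi> ^ n"]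
      unfolding set_lebesgue_integral_def
      by (auto simp: mult.commute[of "indicat_real _ _"] intro!: continuous_intros isCont_diff)
  qed
  then have "real (Suc (Suc n)) * (LBINT \<phi>:{0..pi}. cos \<phi> ^ Suc (Suc n)) = real (Suc n) * (LBINT \<phi>:{0..pi}. cos \<phi> ^ n)"
    by (subst (asm) set_integral_diff(2)[OF i i]) (simp del: power_Suc)
  then show ?thesis by (simp add: field_simps del: power_Suc)
qed

lemma LBINT_cos_power:
  "(LBINT \<phi>:{0..pi}. cos \<phi> ^ (2 * n)) = pi * fact (2 * n) / (4 ^ n * (fact n)\<^sup>2)"
  "(LBINT \<phi>:{0..pi}. cos \<phi> ^ (2 * n + 1)) = 0"
proof -
  show "(LBINT \<phi>:{0..pi}. cos \<phi> ^ (2 * n)) = pi * fact (2 * n) / (4 ^ n * (fact n)\<^sup>2)"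
  proof (induction n)
    case 0
    show ?case by (simp add: set_lebesgue_integral_def)
  next
    case (Suc n)
    have e: "2 * Suc n = Suc (Suc (2 * n))" by simp
    have *: "(2 * N - 1) / (2 * N) * (pi * F / (P * c\<^sup>2)) = pi * (2 * N * (2 * N - 1) * F) / (4 * P * (N * c)\<^sup>2)"
      if "N > 0" "P > 0" "c > 0" for N F P c :: real
      using that by (simp add: divide_simps power2_eq_square)
    show ?case unfolding e LBINT_cos_power_Suc_Suc Suc
      using *[where N = "real n + 1" and F = "fact (2 * n)" and P = "4 ^ n" and c = "fact n"] by (simp add: algebra_simps)
  qed
  show "(LBINT \<phi>:{0..pi}. cos \<phi> ^ (2 * n + 1)) = 0"
  proof (induction n)
    case 0
    show ?case using LBINT_cos_0_pi by simp
  next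
    case (Suc n)
    have e: "2 * Suc n + 1 = Suc (Suc (2 * n + 1))" by simp
    show ?case unfolding e LBINT_cos_power_Suc_Suc Suc by simp
  qed
qed

text \<open>This is the series of pi times the modified Bessel function of order 0 at
  \<open>z\<close>. The exponential series is integrated term by term, dominated by the series of
  \<open>exp \<bar>z\<bar>\<close>, and the odd powers of the cosine integrate to zero.\<close>

lemma exp_cos_integral_sums:
  "(\<lambda>n. pi * (z / 2) ^ (2 * n) / (fact n)\<^sup>2) sums (LBINT \<phi>:{0..pi}. exp (z * cos \<phi>))"
proof -
  let ?f = "\<lambda>n \<phi>. indicator {0..pi} \<phi> *\<^sub>R ((z * cos \<phi>) ^ n /\<^sub>R fact n)"
  have int: "integrable lborel (?f n)" for n
    unfolding set_integrable_def[symmetric] by (intro borel_integrable_atLeastAtMost' continuous_intros)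
  have nb: "norm (?f n \<phi>) \<le> indicator {0..pi} \<phi> * (\<bar>z\<bar> ^ n /\<^sub>R fact n)" for n \<phi>
  proof -
    have "\<bar>z * cos \<phi>\<bar> ^ n \<le> \<bar>z\<bar> ^ n"
      using mult_left_mono[OF abs_cos_le_one[of \<phi>], of "\<bar>z\<bar>"] by (intro power_mono) (auto simp: abs_mult)
    then show ?thesis by (auto simp: indicator_def power_abs abs_mult divide_simps)
  qed
  have summ: "summable (\<lambda>n. \<bar>z\<bar> ^ n /\<^sub>R fact n)"
    using summable_exp_generic[of "\<bar>z\<bar>"] by simp
  have "(\<lambda>n. integral\<^sup>L lborel (?f n)) sums (\<integral>\<phi>. (\<Sum>n. ?f n \<phi>) \<partial>lborel)"
  proof (rule sums_integral[OF int])
    show "AE \<phi> in lborel. summable (\<lambda>n. norm (?f n \<phi>))"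
    proof (rule AE_I2)
      fix \<phi>
      show "summable (\<lambda>n. norm (?f n \<phi>))"
        by (rule summable_comparison_test'[OF summable_mult[OF summ, of "indicator {0..pi} \<phi>"], of 0]) (use nb in simp)
    qed
    show "summable (\<lambda>n. \<integral>\<phi>. norm (?f n \<phi>) \<partial>lborel)"
    proof (rule summable_comparison_test'[OF summable_mult[OF summ, of pi], of 0])
      fix n
      have "(\<integral>\<phi>. norm (?f n \<phi>) \<partial>lborel) \<le> (\<integral>\<phi>. indicator {0..pi} \<phi> * (\<bar>z\<bar> ^ n /\<^sub>R fact n) \<partial>lborel)"
        using int nb by (intro integral_mono integrable_norm) auto
      then show "norm (\<integral>\<phi>. norm (?f n \<phi>) \<partial>lborel) \<le> pi * (\<bar>z\<bar> ^ n /\<^sub>R fact n)"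
        by simp
    qed
  qed
  also have "(\<integral>\<phi>. (\<Sum>n. ?f n \<phi>) \<partial>lborel) = (LBINT \<phi>:{0..pi}. exp (z * cos \<phi>))"
    unfolding set_lebesgue_integral_def
    by (intro Bochner_Integration.integral_cong refl) (simp add: indicator_def exp_def)
  finally have s: "(\<lambda>n. integral\<^sup>L lborel (?f n)) sums (LBINT \<phi>:{0..pi}. exp (z * cos \<phi>))" .
  have v: "integral\<^sup>L lborel (?f n) = z ^ n / fact n * (LBINT \<phi>:{0..pi}. cos \<phi> ^ n)" for n
    unfolding set_lebesgue_integral_def
    by (subst integral_mult_right_zero[symmetric]) (auto intro!: Bochner_Integration.integral_cong simp: power_mult_distrib field_simps)
  have "integral\<^sup>L lborel (?f n) = 0" if "n \<notin> range ((*) 2)" for n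
  proof -
    from that have "odd n" by auto
    then obtain m where "n = 2 * m + 1" by (elim oddE)
    then show ?thesis unfolding v using LBINT_cos_power(2)[of m] by simp
  qed
  then have "(\<lambda>n. integral\<^sup>L lborel (?f (2 * n))) sums (LBINT \<phi>:{0..pi}. exp (z * cos \<phi>))"
    using s by (subst sums_mono_reindex[of "(*) 2"]) (auto simp: strict_mono_def)
  moreover have "integral\<^sup>L lborel (?f (2 * n)) = pi * (z / 2) ^ (2 * n) / (fact n)\<^sup>2" for n
    unfolding v LBINT_cos_power by (simp add: power_mult power_divide)
  ultimately show ?thesis by simp
qed

lemma nn_integral_odd_gaussian:
  fixes c :: real
  assumes "0 < c"
  shows "(\<integral>\<^sup>+x. ennreal (indicator {0<..} x * (x ^ (2 * n + 1) * exp (- (c * x\<^sup>2)))) \<partial>lborel)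
    = ennreal (fact n / (2 * c ^ (n + 1)))"
proof -
  let ?k = "sqrt c"
  have k: "?k > 0" "?k ^ 2 = c" using assms by auto
  have "ennreal (fact n / 2) = (\<integral>\<^sup>+x. ennreal (indicator {0..} x *\<^sub>R (exp (-x\<^sup>2)*x^(2 * n + 1))) \<partial>lborel)"
    using gaussian_moment_odd_pos[of n] unfolding has_bochner_integral_iff
    by (subst nn_integral_eq_integral) (auto simp: indicator_def)
  also have "\<dots> = ennreal ?k * (\<integral>\<^sup>+x. ennreal (indicator {0..} (?k * x) *\<^sub>R (exp (-(?k * x)\<^sup>2)*(?k * x)^(2 * n + 1))) \<partial>lborel)"
    using k by (subst nn_integral_real_affine[where c = ?k and t = 0]) auto
  also have "\<dots> = (\<integral>\<^sup>+x. ennreal (c ^ (n + 1)) * ennreal (indicator {0<..} x * (x ^ (2 * n + 1) * exp (- (c * x\<^sup>2)))) \<partial>lborel)"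
  proof (subst nn_integral_cmult[symmetric], simp, rule nn_integral_cong)
    fix x :: real
    have "c ^ (n + 1) = ?k * ?k ^ (2 * n + 1)"
    proof -
      have "y * y ^ (2 * n + 1) = (y ^ 2) ^ (n + 1)" for y :: real
        by (simp add: power_add power_mult power2_eq_square power_mult_distrib)
      from this[of ?k] show ?thesis unfolding k(2) by simp
    qed
    moreover have "(?k * x)\<^sup>2 = c * x\<^sup>2" using k(2) by (simp add: power_mult_distrib)
    moreover have "(?k * x) ^ (2 * n + 1) = ?k ^ (2 * n + 1) * x ^ (2 * n + 1)" by (rule power_mult_distrib)
    ultimately have "?k * (exp (-(?k * x)\<^sup>2)*(?k * x)^(2 * n + 1)) = c ^ (n + 1) * (x ^ (2 * n + 1) * exp (- (c * x\<^sup>2)))"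
      by (simp del: power_Suc)
    moreover have "0 \<le> c ^ (n + 1)" using assms by simp
    moreover have "indicator {0..} (?k * x) = (indicator {0..} x :: real)" using k(1) by (auto simp: indicator_def zero_le_mult_iff)
    ultimately show "ennreal ?k * ennreal (indicator {0..} (?k * x) *\<^sub>R (exp (-(?k * x)\<^sup>2)*(?k * x)^(2 * n + 1)))
      = ennreal (c ^ (n + 1)) * ennreal (indicator {0<..} x * (x ^ (2 * n + 1) * exp (- (c * x\<^sup>2))))"
      using k(1) by (cases "x = 0"; cases "0 < x") (simp_all add: indicator_def ennreal_mult'[symmetric] del: power_Suc)
  qed
  also have "\<dots> = ennreal (c ^ (n + 1)) * (\<integral>\<^sup>+x. ennreal (indicator {0<..} x * (x ^ (2 * n + 1) * exp (- (c * x\<^sup>2)))) \<partial>lborel)"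
    by (rule nn_integral_cmult) simp
  finally have "ennreal (1 / c ^ (n + 1)) * ennreal (fact n / 2) = (ennreal (1 / c ^ (n + 1)) * ennreal (c ^ (n + 1))) * (\<integral>\<^sup>+x. ennreal (indicator {0<..} x * (x ^ (2 * n + 1) * exp (- (c * x\<^sup>2)))) \<partial>lborel)"
    by (simp only: mult.assoc)
  moreover have "ennreal (1 / c ^ (n + 1)) * ennreal (c ^ (n + 1)) = 1"
    "ennreal (1 / c ^ (n + 1)) * ennreal (fact n / 2) = ennreal (fact n / (2 * c ^ (n + 1)))"
    using assms by (simp_all add: ennreal_mult'[symmetric] del: power_Suc)
  ultimately show ?thesis by simp
qed

text \<open>In polar coordinates this is the integral over a half plane of a Gaussian times the
  exponential of a linear function, hence half of the full value
  \<open>pi / c * exp (z^2 / c)\<close>. In the series, the moment of order \<open>2 * n + 1\<close>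
  contributes \<open>fact n\<close>, which cancels one of the two factorials and leaves an
  exponential series.\<close>

lemma nn_integral_gaussian_bessel:
  fixes c z :: real
  assumes "0 < c"
  shows "(\<integral>\<^sup>+x. ennreal (indicator {0<..} x * (x * exp (- (c * x\<^sup>2)) * (LBINT \<phi>:{0..pi}. exp (2 * z * x * cos \<phi>)))) \<partial>lborel)
    = ennreal (pi / (2 * c) * exp (z\<^sup>2 / c))"
proof -
  let ?g = "\<lambda>n x. indicator {0<..} x * (x * exp (- (c * x\<^sup>2)) * (pi * (z * x) ^ (2 * n) / (fact n)\<^sup>2)) :: real"
  have "(\<integral>\<^sup>+x. ennreal (indicator {0<..} x * (x * exp (- (c * x\<^sup>2)) * (LBINT \<phi>:{0..pi}. exp (2 * z * x * cos \<phi>)))) \<partial>lborel)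
    = (\<integral>\<^sup>+x. (\<Sum>n. ennreal (?g n x)) \<partial>lborel)"
  proof (rule nn_integral_cong)
    fix x :: real
    have "(\<lambda>n. ?g n x) sums (indicator {0<..} x * (x * exp (- (c * x\<^sup>2)) * (LBINT \<phi>:{0..pi}. exp (2 * z * x * cos \<phi>))))"
      using exp_cos_integral_sums[of "2 * z * x"] by (intro sums_mult) simp
    moreover have "0 \<le> ?g n x" for n by (auto simp: indicator_def power_mult)
    ultimately show "ennreal (indicator {0<..} x * (x * exp (- (c * x\<^sup>2)) * (LBINT \<phi>:{0..pi}. exp (2 * z * x * cos \<phi>)))) = (\<Sum>n. ennreal (?g n x))"
      by (intro suminf_ennreal_eq[symmetric])
  qed
  also have "\<dots> = (\<Sum>n. \<integral>\<^sup>+x. ennreal (?g n x) \<partial>lborel)"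
    by (rule nn_integral_suminf) simp
  also have "\<dots> = (\<Sum>n. ennreal (pi / (2 * c) * ((z\<^sup>2 / c) ^ n /\<^sub>R fact n)))"
  proof (rule suminf_cong)
    fix n
    have "(\<integral>\<^sup>+x. ennreal (?g n x) \<partial>lborel) = (\<integral>\<^sup>+x. ennreal (pi * z ^ (2 * n) / (fact n)\<^sup>2) * ennreal (indicator {0<..} x * (x ^ (2 * n + 1) * exp (- (c * x\<^sup>2)))) \<partial>lborel)"
    proof (rule nn_integral_cong)
      fix x :: real
      have "0 \<le> pi * z ^ (2 * n) / (fact n)\<^sup>2" by (simp add: power_mult)
      moreover have "?g n x = pi * z ^ (2 * n) / (fact n)\<^sup>2 * (indicator {0<..} x * (x ^ (2 * n + 1) * exp (- (c * x\<^sup>2))))"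
        by (simp add: power_mult_distrib)
      ultimately show "ennreal (?g n x) = ennreal (pi * z ^ (2 * n) / (fact n)\<^sup>2) * ennreal (indicator {0<..} x * (x ^ (2 * n + 1) * exp (- (c * x\<^sup>2))))"
        by (simp only: ennreal_mult'[symmetric])
    qed
    also have "\<dots> = ennreal (pi * z ^ (2 * n) / (fact n)\<^sup>2) * ennreal (fact n / (2 * c ^ (n + 1)))"
      by (subst nn_integral_cmult, simp) (subst nn_integral_odd_gaussian[OF assms], rule refl)
    also have "\<dots> = ennreal (pi / (2 * c) * ((z\<^sup>2 / c) ^ n /\<^sub>R fact n))"
    proof -
      have "pi * z ^ (2 * n) / (fact n)\<^sup>2 * (fact n / (2 * c ^ (n + 1))) = pi / (2 * c) * ((z\<^sup>2 / c) ^ n /\<^sub>R fact n)"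
        using assms by (simp add: power_mult power_divide power2_eq_square divide_simps)
      then show ?thesis by (subst ennreal_mult'[symmetric]) (simp_all add: power_mult)
    qed
    finally show "(\<integral>\<^sup>+x. ennreal (?g n x) \<partial>lborel) = ennreal (pi / (2 * c) * ((z\<^sup>2 / c) ^ n /\<^sub>R fact n))" .
  qed
  also have "\<dots> = ennreal (pi / (2 * c) * exp (z\<^sup>2 / c))"
    using assms by (intro suminf_ennreal_eq sums_mult exp_converges) auto
  finally show ?thesis .
qed

section \<open>Gamma and Beta integrals by Tonelli\<close>

lemma nn_integral_ennreal_cmult:
  fixes f :: "'a \<Rightarrow> real"
  assumes "0 \<le> c" and [measurable]: "f \<in> borel_measurable M"
  shows "(\<integral>\<^sup>+x. ennreal (c * f x) \<partial>M) = ennreal c * (\<integral>\<^sup>+x. ennreal (f x) \<partial>M)"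
  using assms(1) by (simp add: ennreal_mult' nn_integral_cmult)

lemma nn_integral_ennreal_swap:
  fixes f :: "real \<Rightarrow> real \<Rightarrow> real"
  assumes "case_prod f \<in> borel_measurable (lborel \<Otimes>\<^sub>M lborel)"
  shows "(\<integral>\<^sup>+x. \<integral>\<^sup>+y. ennreal (f x y) \<partial>lborel \<partial>lborel) = (\<integral>\<^sup>+y. \<integral>\<^sup>+x. ennreal (f x y) \<partial>lborel \<partial>lborel)"
  using assms by (intro lborel_pair.Fubini'[symmetric]) (simp add: split_beta')

text \<open>The Beta integral on the half line. Writing the power of \<open>c + v\<close> as a Gamma
  integral makes the integrand separate into a Gamma integral in \<open>v\<close> and one in
  \<open>s\<close>.\<close>

lemma nn_integral_powr_over_add:
  fixes p r c :: real
  assumes "0 < p" "0 < r" "0 < c"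
  shows "(\<integral>\<^sup>+v. ennreal (indicator {0<..} v * (v powr (p - 1) * (c + v) powr (- (p + r)))) \<partial>lborel)
    = ennreal (Gamma p * Gamma r / Gamma (p + r) * c powr (- r))"
proof -
  have G: "Gamma (p + r) > 0" using assms by simp
  let ?f = "\<lambda>v s. indicator {0<..} v * v powr (p - 1) * (indicator {0<..} s * (s powr (p + r - 1) * exp (- ((c + v) * s)))) :: real"
  have "ennreal (Gamma (p + r)) * (\<integral>\<^sup>+v. ennreal (indicator {0<..} v * (v powr (p - 1) * (c + v) powr (- (p + r)))) \<partial>lborel)
    = (\<integral>\<^sup>+v. ennreal (Gamma (p + r) * (indicator {0<..} v * (v powr (p - 1) * (c + v) powr (- (p + r))))) \<partial>lborel)"
    using G by (subst nn_integral_ennreal_cmult) auto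
  also have "\<dots> = (\<integral>\<^sup>+v. \<integral>\<^sup>+s. ennreal (?f v s) \<partial>lborel \<partial>lborel)"
  proof (rule nn_integral_cong)
    fix v :: real
    show "ennreal (Gamma (p + r) * (indicator {0<..} v * (v powr (p - 1) * (c + v) powr (- (p + r))))) = (\<integral>\<^sup>+s. ennreal (?f v s) \<partial>lborel)"
    proof (cases "0 < v")
      case True
      then show ?thesis using assms nn_integral_powr_exp[of "p + r" "c + v"]
        by (subst nn_integral_ennreal_cmult) (simp_all add: mult_ac flip: ennreal_mult')
    qed simp
  qed
  also have "\<dots> = (\<integral>\<^sup>+s. \<integral>\<^sup>+v. ennreal (?f v s) \<partial>lborel \<partial>lborel)"
    by (rule nn_integral_ennreal_swap) measurable
  also have "\<dots> = (\<integral>\<^sup>+s. ennreal (Gamma p * (indicator {0<..} s * (s powr (r - 1) * exp (- (c * s))))) \<partial>lborel)"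
  proof (rule nn_integral_cong)
    fix s :: real
    show "(\<integral>\<^sup>+v. ennreal (?f v s) \<partial>lborel) = ennreal (Gamma p * (indicator {0<..} s * (s powr (r - 1) * exp (- (c * s)))))"
    proof (cases "0 < s")
      case True
      have "(\<integral>\<^sup>+v. ennreal (?f v s) \<partial>lborel) = (\<integral>\<^sup>+v. ennreal (s powr (p + r - 1) * exp (- (c * s)) * (indicator {0<..} v * (v powr (p - 1) * exp (- (s * v))))) \<partial>lborel)"
        using True by (intro nn_integral_cong) (simp add: algebra_simps exp_add exp_diff exp_minus divide_inverse)
      also have "\<dots> = ennreal (s powr (p + r - 1) * exp (- (c * s)) * (Gamma p * s powr (- p)))"
        using True assms nn_integral_powr_exp[of p s] by (subst nn_integral_ennreal_cmult) (simp_all flip: ennreal_mult')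
      also have "s powr (p + r - 1) * exp (- (c * s)) * (Gamma p * s powr (- p)) = Gamma p * (s powr (r - 1) * exp (- (c * s)))"
        by (simp add: mult_ac flip: powr_add)
      finally show ?thesis using True by simp
    qed simp
  qed
  also have "\<dots> = ennreal (Gamma p * (Gamma r * c powr (- r)))"
    using assms nn_integral_powr_exp[of r c] Gamma_real_pos[of p] by (subst nn_integral_ennreal_cmult) (simp_all flip: ennreal_mult')
  finally have "ennreal (1 / Gamma (p + r)) * ennreal (Gamma p * (Gamma r * c powr (- r)))
     = (ennreal (1 / Gamma (p + r)) * ennreal (Gamma (p + r))) * (\<integral>\<^sup>+v. ennreal (indicator {0<..} v * (v powr (p - 1) * (c + v) powr (- (p + r)))) \<partial>lborel)"
    by (simp add: mult.assoc)
  then show ?thesis using G by (simp add: mult_ac ennreal_mult'[symmetric])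
qed

text \<open>Since \<open>1 - exp (- (w * s))\<close> is the integral of
  \<open>s * exp (- (y * s))\<close> over \<open>y\<close> from 0 to \<open>w\<close>, the exponent
  \<open>p - 2\<close> is raised to \<open>p - 1\<close>, and swapping leaves a Gamma integral in
  \<open>s\<close>. The remaining \<open>y powr (- p)\<close> is integrable at 0 because
  \<open>p < 1\<close>.\<close>

lemma nn_integral_powr_one_minus_exp:
  fixes p w :: real
  assumes "0 < p" "p < 1" "0 < w"
  shows "(\<integral>\<^sup>+s. ennreal (indicator {0<..} s * (s powr (p - 2) * (1 - exp (- (w * s))))) \<partial>lborel)
    = ennreal (Gamma p / (1 - p) * w powr (1 - p))"
proof -
  \<comment> \<open>The interval for \<open>y\<close> omits 0, where the integral over
    \<open>s\<close> diverges; with \<open>0 powr (- p) = 0\<close> the identity after the swap then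
    holds at every \<open>y\<close>.\<close>
  let ?f = "\<lambda>s y. indicator {0<..w} y * (indicator {0<..} s * (s powr (p - 1) * exp (- (y * s)))) :: real"
  have "(\<integral>\<^sup>+s. ennreal (indicator {0<..} s * (s powr (p - 2) * (1 - exp (- (w * s))))) \<partial>lborel)
    = (\<integral>\<^sup>+s. \<integral>\<^sup>+y. ennreal (?f s y) \<partial>lborel \<partial>lborel)"
  proof (rule nn_integral_cong)
    fix s :: real
    show "ennreal (indicator {0<..} s * (s powr (p - 2) * (1 - exp (- (w * s))))) = (\<integral>\<^sup>+y. ennreal (?f s y) \<partial>lborel)"
    proof (cases "0 < s")
      case True
      have "(\<integral>\<^sup>+y. ennreal (s * exp (- (y * s))) * indicator {0..w} y \<partial>lborel) = ennreal (- exp (- (w * s)) - (- exp (- (0 * s))))"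
        using True assms by (intro nn_integral_FTC_Icc) (auto intro!: derivative_eq_intros)
      moreover have "(\<integral>\<^sup>+y. ennreal (s * exp (- (y * s))) * indicator {0..w} y \<partial>lborel) = (\<integral>\<^sup>+y. ennreal (indicator {0<..w} y * (s * exp (- (y * s)))) \<partial>lborel)"
        by (intro nn_integral_cong_AE eventually_mono[OF AE_lborel_singleton[of 0]]) (auto simp: indicator_def)
      ultimately have *: "(\<integral>\<^sup>+y. ennreal (indicator {0<..w} y * (s * exp (- (y * s)))) \<partial>lborel) = ennreal (1 - exp (- (w * s)))"
        by simp
      have "s powr (p - 1) = s powr (p - 2) * s" using True powr_mult_base[of s "p - 2"] by (simp add: mult.commute)
      then have "(\<integral>\<^sup>+y. ennreal (?f s y) \<partial>lborel) = (\<integral>\<^sup>+y. ennreal (s powr (p - 2) * (indicator {0<..w} y * (s * exp (- (y * s))))) \<partial>lborel)"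
        using True by (intro nn_integral_cong) (simp add: mult_ac)
      also have "\<dots> = ennreal (s powr (p - 2)) * ennreal (1 - exp (- (w * s)))"
        unfolding *[symmetric] by (rule nn_integral_ennreal_cmult) auto
      finally show ?thesis using True by (simp add: ennreal_mult')
    qed simp
  qed
  also have "\<dots> = (\<integral>\<^sup>+y. \<integral>\<^sup>+s. ennreal (?f s y) \<partial>lborel \<partial>lborel)"
    by (rule nn_integral_ennreal_swap) measurable
  also have "\<dots> = (\<integral>\<^sup>+y. ennreal (Gamma p * (indicator {0..w} y * y powr (- p))) \<partial>lborel)"
  proof (rule nn_integral_cong)
    fix y :: real
    show "(\<integral>\<^sup>+s. ennreal (?f s y) \<partial>lborel) = ennreal (Gamma p * (indicator {0..w} y * y powr (- p)))"
    proof (cases "0 < y \<and> y \<le> w")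
      case True
      then show ?thesis using assms nn_integral_powr_exp[of p y] by simp
    next
      case False
      then show ?thesis by (cases "y = 0") (auto simp: indicator_def)
    qed
  qed
  also have "\<dots> = ennreal (Gamma p) * (\<integral>\<^sup>+y. ennreal (indicator {0..w} y * y powr (- p)) \<partial>lborel)"
    using assms Gamma_real_pos[of p] by (intro nn_integral_ennreal_cmult) auto
  also have "(\<integral>\<^sup>+y. ennreal (indicator {0..w} y * y powr (- p)) \<partial>lborel) = ennreal (w powr (1 - p) / (1 - p))"
  proof -
    have "((\<lambda>y. y powr (- p)) has_integral (w powr (- p + 1) / (- p + 1))) {0..w}"
      using assms by (intro has_integral_powr_from_0) auto
    then show ?thesis
      using nn_integral_has_integral_lebesgue[of "{0..w}" "\<lambda>y. y powr (- p)" "w powr (1 - p) / (1 - p)"] by (simp add: mult.commute)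
  qed
  finally show ?thesis using assms Gamma_real_pos[of p] by (simp add: ennreal_mult'[symmetric])
qed

text \<open>Putting \<open>t = s * v\<close> collects the powers of \<open>s\<close> to
  \<open>2 * a - 2\<close>, and \<open>s * t / (s + t)\<close> becomes linear in \<open>s\<close>.
  The integral over \<open>s\<close> needs \<open>2 * a < 1\<close> and leaves the weight
  \<open>v powr (- a) * (1 + v) powr (2 * a - 2)\<close>, a Beta integral with both parameters
  \<open>1 - a\<close>; this is where the square of \<open>Gamma (1 - a)\<close> comes from.\<close>

lemma nn_integral_heat_kernel:
  fixes a :: real
  assumes "0 < a" "a < 1/2"
  shows "(\<integral>\<^sup>+s. ennreal (indicator {0<..} s * s powr (a - 1)) *
      (\<integral>\<^sup>+t. ennreal (indicator {0<..} t * (t powr (a - 1) / (s + t) * (1 - exp (- (s * t / (s + t)))))) \<partial>lborel) \<partial>lborel)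
    = ennreal (Gamma (2 * a) / (1 - 2 * a) * ((Gamma (1 - a))\<^sup>2 / Gamma (2 - 2 * a)))"
proof -
  let ?f = "\<lambda>s v. indicator {0<..} v * (v powr (a - 1) / (1 + v)) * (indicator {0<..} s * (s powr (2 * a - 2) * (1 - exp (- (v / (1 + v) * s))))) :: real"
  have "(\<integral>\<^sup>+s. ennreal (indicator {0<..} s * s powr (a - 1)) *
      (\<integral>\<^sup>+t. ennreal (indicator {0<..} t * (t powr (a - 1) / (s + t) * (1 - exp (- (s * t / (s + t)))))) \<partial>lborel) \<partial>lborel)
     = (\<integral>\<^sup>+s. \<integral>\<^sup>+v. ennreal (?f s v) \<partial>lborel \<partial>lborel)"
  proof (rule nn_integral_cong)
    fix s :: real
    show "ennreal (indicator {0<..} s * s powr (a - 1)) *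
      (\<integral>\<^sup>+t. ennreal (indicator {0<..} t * (t powr (a - 1) / (s + t) * (1 - exp (- (s * t / (s + t)))))) \<partial>lborel) = (\<integral>\<^sup>+v. ennreal (?f s v) \<partial>lborel)"
    proof (cases "0 < s")
      case True
      have "(\<integral>\<^sup>+t. ennreal (indicator {0<..} t * (t powr (a - 1) / (s + t) * (1 - exp (- (s * t / (s + t)))))) \<partial>lborel)
        = ennreal s * (\<integral>\<^sup>+v. ennreal (indicator {0<..} (s * v) * ((s * v) powr (a - 1) / (s + s * v) * (1 - exp (- (s * (s * v) / (s + s * v)))))) \<partial>lborel)"
        using True by (subst nn_integral_real_affine[where c = s and t = 0]) auto
      then have "ennreal (indicator {0<..} s * s powr (a - 1)) *
        (\<integral>\<^sup>+t. ennreal (indicator {0<..} t * (t powr (a - 1) / (s + t) * (1 - exp (- (s * t / (s + t)))))) \<partial>lborel)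
        = ennreal (s powr (a - 1) * s) * (\<integral>\<^sup>+v. ennreal (indicator {0<..} (s * v) * ((s * v) powr (a - 1) / (s + s * v) * (1 - exp (- (s * (s * v) / (s + s * v)))))) \<partial>lborel)"
        using True by (simp add: mult.assoc ennreal_mult')
      also have "\<dots> = (\<integral>\<^sup>+v. ennreal ((s powr (a - 1) * s) * (indicator {0<..} (s * v) * ((s * v) powr (a - 1) / (s + s * v) * (1 - exp (- (s * (s * v) / (s + s * v))))))) \<partial>lborel)"
        using True by (subst nn_integral_ennreal_cmult) auto
      also have "\<dots> = (\<integral>\<^sup>+v. ennreal (?f s v) \<partial>lborel)"
      proof (rule nn_integral_cong)
        fix v :: real
        show "ennreal ((s powr (a - 1) * s) * (indicator {0<..} (s * v) * ((s * v) powr (a - 1) / (s + s * v) * (1 - exp (- (s * (s * v) / (s + s * v))))))) = ennreal (?f s v)"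
        proof (cases "0 < v")
          case v: True
          have "s + s * v = s * (1 + v)" by (simp add: algebra_simps)
          moreover have "s * (s * v) / (s * (1 + v)) = v / (1 + v) * s" using True v by simp
          moreover have "s powr (2 * a - 2) = s powr (a - 1) * s powr (a - 1)" by (simp flip: powr_add)
          moreover have "(s * v) powr (a - 1) = s powr (a - 1) * v powr (a - 1)" using True v by (simp add: powr_mult)
          ultimately show ?thesis using True v by (simp add: mult_ac)
        qed (use True in \<open>simp add: indicator_def zero_less_mult_iff\<close>)
      qed
      finally show ?thesis .
    qed simp
  qed
  also have "\<dots> = (\<integral>\<^sup>+v. \<integral>\<^sup>+s. ennreal (?f s v) \<partial>lborel \<partial>lborel)"
    by (rule nn_integral_ennreal_swap) measurable
  also have "\<dots> = (\<integral>\<^sup>+v. ennreal (Gamma (2 * a) / (1 - 2 * a) * (indicator {0<..} v * (v powr ((1 - a) - 1) * (1 + v) powr (- ((1 - a) + (1 - a)))))) \<partial>lborel)"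
  proof (rule nn_integral_cong)
    fix v :: real
    show "(\<integral>\<^sup>+s. ennreal (?f s v) \<partial>lborel) = ennreal (Gamma (2 * a) / (1 - 2 * a) * (indicator {0<..} v * (v powr ((1 - a) - 1) * (1 + v) powr (- ((1 - a) + (1 - a))))))"
    proof (cases "0 < v")
      case True
      have "(\<integral>\<^sup>+s. ennreal (?f s v) \<partial>lborel) = ennreal (v powr (a - 1) / (1 + v)) * ennreal (Gamma (2 * a) / (1 - 2 * a) * (v / (1 + v)) powr (1 - 2 * a))"
        using True assms nn_integral_powr_one_minus_exp[of "2 * a" "v / (1 + v)"] by (subst nn_integral_ennreal_cmult) auto
      also have "\<dots> = ennreal (v powr (a - 1) / (1 + v) * (Gamma (2 * a) / (1 - 2 * a) * (v / (1 + v)) powr (1 - 2 * a)))"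
        using True by (intro ennreal_mult'[symmetric]) auto
      also have "v powr (a - 1) / (1 + v) * (Gamma (2 * a) / (1 - 2 * a) * (v / (1 + v)) powr (1 - 2 * a))
        = Gamma (2 * a) / (1 - 2 * a) * (v powr ((1 - a) - 1) * (1 + v) powr (- ((1 - a) + (1 - a))))"
      proof -
        have "v powr (a - 1) * v powr (1 - 2 * a) = v powr ((1 - a) - 1)" by (simp flip: powr_add)
        moreover have "(1 + v) powr (- ((1 - a) + (1 - a))) = 1 / ((1 + v) * (1 + v) powr (1 - 2 * a))"
          using True powr_mult_base[of "1 + v" "1 - 2 * a"] powr_minus_divide[of "1 + v" "1 - a + (1 - a)"] by (simp add: algebra_simps)
        moreover have "v powr (a - 1) / (1 + v) * (Gamma (2 * a) / (1 - 2 * a) * (v / (1 + v)) powr (1 - 2 * a))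
          = Gamma (2 * a) / (1 - 2 * a) * ((v powr (a - 1) * v powr (1 - 2 * a)) * (1 / ((1 + v) * (1 + v) powr (1 - 2 * a))))"
          by (simp add: powr_divide mult_ac)
        ultimately show ?thesis by (simp only:)
      qed
      finally show ?thesis using True by simp
    qed simp
  qed
  also have "\<dots> = ennreal (Gamma (2 * a) / (1 - 2 * a)) * ennreal (Gamma (1 - a) * Gamma (1 - a) / Gamma (1 - a + (1 - a)) * 1 powr (- (1 - a)))"
    using assms Gamma_real_pos[of "2 * a"] nn_integral_powr_over_add[of "1 - a" "1 - a" 1] by (subst nn_integral_ennreal_cmult) auto
  also have "\<dots> = ennreal (Gamma (2 * a) / (1 - 2 * a) * ((Gamma (1 - a))\<^sup>2 / Gamma (2 - 2 * a)))"
    using assms Gamma_real_pos[of "2 * a"] by (simp add: ennreal_mult'[symmetric] power2_eq_square)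
  finally show ?thesis .
qed

section \<open>Distances to the unit circle and their Gaussian averages\<close>

lemma plane_dist_sq: "x\<^sup>2 + 1 - 2 * x * cos \<phi> = (x - 1)\<^sup>2 + 2 * x * (1 - cos \<phi>)" for x :: real
  by (simp add: power2_eq_square algebra_simps)

lemma plane_dist_sq_ge: "0 \<le> x \<Longrightarrow> (x - 1)\<^sup>2 \<le> x\<^sup>2 + 1 - 2 * x * cos \<phi>" for x :: real
  unfolding plane_dist_sq by simp

lemma plane_dist_sq_pos: "0 \<le> x \<Longrightarrow> x \<noteq> 1 \<Longrightarrow> 0 < x\<^sup>2 + 1 - 2 * x * cos \<phi>" for x :: real
  by (rule less_le_trans[OF _ plane_dist_sq_ge]) auto

lemma nn_integral_Icc_eq_LBINT:
  fixes f :: "real \<Rightarrow> real"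
  assumes "continuous_on {a..b} f" "\<And>x. x \<in> {a..b} \<Longrightarrow> 0 \<le> f x"
  shows "(\<integral>\<^sup>+x. ennreal (indicator {a..b} x * f x) \<partial>lborel) = ennreal (LBINT x:{a..b}. f x)"
  using borel_integrable_atLeastAtMost'[OF assms(1)] assms(2)
  unfolding set_lebesgue_integral_def set_integrable_def
  by (subst nn_integral_eq_integral) (auto simp: indicator_def)

text \<open>By the law of cosines the base is the squared distance between a point at radius
  \<open>x\<close> and the point of the unit circle at angle \<open>\<phi>\<close>. By symmetry the
  half circle suffices, and the integral is pi times the circular mean of the inverse distance to
  the power \<open>q\<close>.\<close>

definition plane_R :: "real \<Rightarrow> real \<Rightarrow> real" where
  "plane_R q x = (LBINT \<phi>:{0..pi}. (x\<^sup>2 + 1 - 2 * x * cos \<phi>) powr (- q / 2))"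

definition plane_E :: "real \<Rightarrow> real \<Rightarrow> real" where
  "plane_E t x = (LBINT \<phi>:{0..pi}. exp (- (t * (x\<^sup>2 + 1 - 2 * x * cos \<phi>))))"

definition plane_H :: "real \<Rightarrow> real \<Rightarrow> real" where
  "plane_H q x = (LBINT \<phi>:{0..pi}. (x powr (- q) - (x\<^sup>2 + 1 - 2 * x * cos \<phi>) powr (- q / 2)))"

lemma plane_R_measurable [measurable]: "plane_R q \<in> borel_measurable borel"
  unfolding plane_R_def set_lebesgue_integral_def by measurable

lemma plane_H_measurable [measurable]: "plane_H q \<in> borel_measurable borel"
  unfolding plane_H_def set_lebesgue_integral_def by measurable

lemma plane_E_measurable [measurable]: "case_prod plane_E \<in> borel_measurable (lborel \<Otimes>\<^sub>M lborel)"
  unfolding plane_E_def set_lebesgue_integral_def by measurable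

lemma plane_R_nonneg: "0 \<le> plane_R q x" and plane_E_nonneg: "0 \<le> plane_E t x"
  unfolding plane_R_def plane_E_def set_lebesgue_integral_def by (auto intro!: integral_nonneg_AE)

lemma set_integrable_plane_dist_powr:
  assumes "0 \<le> x" "x \<noteq> 1"
  shows "set_integrable lborel {0..pi} (\<lambda>\<phi>. (x\<^sup>2 + 1 - 2 * x * cos \<phi>) powr p)"
  using plane_dist_sq_pos[OF assms]
  by (intro borel_integrable_atLeastAtMost' continuous_intros) (auto simp: less_imp_neq[symmetric])

lemma plane_H_eq:
  assumes "0 \<le> x" "x \<noteq> 1"
  shows "plane_H q x = pi * x powr (- q) - plane_R q x"
proof -
  have "plane_H q x = (LBINT \<phi>:{0..pi}. x powr (- q)) - plane_R q x"
    unfolding plane_H_def plane_R_def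
    by (intro set_integral_diff(2) set_integrable_plane_dist_powr assms borel_integrable_atLeastAtMost' continuous_intros)
  then show ?thesis by (simp add: set_lebesgue_integral_def)
qed

text \<open>A Gaussian of rate \<open>s\<close> centred at the origin meets one of rate
  \<open>t\<close> centred at distance 1. Completing the square gives the total rate
  \<open>s + t\<close> and the exponent \<open>s * t / (s + t)\<close>.\<close>

lemma nn_integral_two_gaussians:
  assumes "0 < s" "0 < t"
  shows "(\<integral>\<^sup>+x. ennreal (indicator {0<..} x * (x * exp (- (s * x\<^sup>2)) * plane_E t x)) \<partial>lborel)
    = ennreal (pi / (2 * (s + t)) * exp (- (s * t / (s + t))))"
proof -
  have E: "plane_E t x = exp (- (t * x\<^sup>2) - t) * (LBINT \<phi>:{0..pi}. exp (2 * t * x * cos \<phi>))" for x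
    unfolding plane_E_def set_lebesgue_integral_def
    by (subst integral_mult_right_zero[symmetric], rule Bochner_Integration.integral_cong)
      (auto simp: algebra_simps indicator_def simp flip: exp_add)
  have "(\<integral>\<^sup>+x. ennreal (indicator {0<..} x * (x * exp (- (s * x\<^sup>2)) * plane_E t x)) \<partial>lborel)
    = (\<integral>\<^sup>+x. ennreal (exp (- t) * (indicator {0<..} x * (x * exp (- ((s + t) * x\<^sup>2)) * (LBINT \<phi>:{0..pi}. exp (2 * t * x * cos \<phi>))))) \<partial>lborel)"
    by (rule nn_integral_cong) (simp add: E algebra_simps exp_diff exp_add exp_minus divide_inverse)
  also have "\<dots> = ennreal (exp (- t)) * ennreal (pi / (2 * (s + t)) * exp (t\<^sup>2 / (s + t)))"
    unfolding nn_integral_gaussian_bessel[OF add_pos_pos[OF assms], symmetric]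
    by (intro nn_integral_ennreal_cmult) (simp_all add: set_lebesgue_integral_def)
  also have "\<dots> = ennreal (exp (- t) * (pi / (2 * (s + t)) * exp (t\<^sup>2 / (s + t))))"
    by (rule ennreal_mult'[symmetric]) simp
  also have "exp (- t) * (pi / (2 * (s + t)) * exp (t\<^sup>2 / (s + t))) = pi / (2 * (s + t)) * exp (- t + t\<^sup>2 / (s + t))"
    unfolding exp_add by simp
  also have "- t + t\<^sup>2 / (s + t) = - (s * t / (s + t))"
    using assms by (simp add: divide_simps power2_eq_square algebra_simps)
  finally show ?thesis .
qed

text \<open>The Gamma integral is applied at each angle and then exchanged with the angular
  integral. For \<open>x \<noteq> 1\<close> the distance is positive at every angle.\<close>

lemma plane_R_heat:
  assumes "0 < a" "0 \<le> x" "x \<noteq> 1"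
  shows "ennreal (Gamma a * plane_R (2 * a) x) = (\<integral>\<^sup>+t. ennreal (indicator {0<..} t * t powr (a - 1) * plane_E t x) \<partial>lborel)"
proof -
  let ?\<rho> = "\<lambda>\<phi>. x\<^sup>2 + 1 - 2 * x * cos \<phi>"
  have \<rho>: "0 < ?\<rho> \<phi>" for \<phi> using assms by (intro plane_dist_sq_pos)
  have "ennreal (Gamma a * plane_R (2 * a) x) = ennreal (Gamma a) * ennreal (plane_R (2 * a) x)"
    using assms by (intro ennreal_mult') simp
  also have "ennreal (plane_R (2 * a) x) = (\<integral>\<^sup>+\<phi>. ennreal (indicator {0..pi} \<phi> * ?\<rho> \<phi> powr (- a)) \<partial>lborel)"
    unfolding plane_R_def using \<rho>
    by (subst nn_integral_Icc_eq_LBINT) (auto intro!: continuous_intros simp: less_imp_neq[symmetric])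
  also have "ennreal (Gamma a) * \<dots> = (\<integral>\<^sup>+\<phi>. ennreal (Gamma a * (indicator {0..pi} \<phi> * ?\<rho> \<phi> powr (- a))) \<partial>lborel)"
    using assms Gamma_real_pos[of a] by (intro nn_integral_ennreal_cmult[symmetric]) auto
  also have "\<dots> = (\<integral>\<^sup>+\<phi>. \<integral>\<^sup>+t. ennreal (indicator {0..pi} \<phi> * (indicator {0<..} t * (t powr (a - 1) * exp (- (?\<rho> \<phi> * t))))) \<partial>lborel \<partial>lborel)"
  proof (rule nn_integral_cong)
    fix \<phi> :: real
    show "ennreal (Gamma a * (indicator {0..pi} \<phi> * ?\<rho> \<phi> powr (- a))) = (\<integral>\<^sup>+t. ennreal (indicator {0..pi} \<phi> * (indicator {0<..} t * (t powr (a - 1) * exp (- (?\<rho> \<phi> * t))))) \<partial>lborel)"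
      using nn_integral_powr_exp[OF assms(1) \<rho>[of \<phi>]] by (simp add: indicator_def)
  qed
  also have "\<dots> = (\<integral>\<^sup>+t. \<integral>\<^sup>+\<phi>. ennreal (indicator {0..pi} \<phi> * (indicator {0<..} t * (t powr (a - 1) * exp (- (?\<rho> \<phi> * t))))) \<partial>lborel \<partial>lborel)"
    by (rule nn_integral_ennreal_swap) measurable
  also have "\<dots> = (\<integral>\<^sup>+t. ennreal (indicator {0<..} t * t powr (a - 1) * plane_E t x) \<partial>lborel)"
  proof (rule nn_integral_cong)
    fix t :: real
    have "(\<integral>\<^sup>+\<phi>. ennreal (indicator {0..pi} \<phi> * (indicator {0<..} t * (t powr (a - 1) * exp (- (?\<rho> \<phi> * t))))) \<partial>lborel)
      = ennreal (LBINT \<phi>:{0..pi}. indicator {0<..} t * (t powr (a - 1) * exp (- (?\<rho> \<phi> * t))))"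
      by (intro nn_integral_Icc_eq_LBINT continuous_intros) (auto simp: indicator_def)
    also have "(LBINT \<phi>:{0..pi}. indicator {0<..} t * (t powr (a - 1) * exp (- (?\<rho> \<phi> * t)))) = indicator {0<..} t * t powr (a - 1) * plane_E t x"
      unfolding plane_E_def by (simp add: mult.commute[of t])
    finally show "(\<integral>\<^sup>+\<phi>. ennreal (indicator {0..pi} \<phi> * (indicator {0<..} t * (t powr (a - 1) * exp (- (?\<rho> \<phi> * t))))) \<partial>lborel) = ennreal (indicator {0<..} t * t powr (a - 1) * plane_E t x)" .
  qed
  finally show ?thesis .
qed

lemma nn_integral_gaussian_plane_R:
  assumes "0 < a" "0 < s"
  shows "ennreal (Gamma a) * (\<integral>\<^sup>+x. ennreal (indicator {0<..} x * (x * exp (- (s * x\<^sup>2)) * plane_R (2 * a) x)) \<partial>lborel)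
    = ennreal (pi / 2) * (\<integral>\<^sup>+t. ennreal (indicator {0<..} t * (t powr (a - 1) / (s + t) * exp (- (s * t / (s + t))))) \<partial>lborel)"
proof -
  let ?w = "\<lambda>x. indicator {0<..} x * (x * exp (- (s * x\<^sup>2))) :: real"
  have "ennreal (Gamma a) * (\<integral>\<^sup>+x. ennreal (indicator {0<..} x * (x * exp (- (s * x\<^sup>2)) * plane_R (2 * a) x)) \<partial>lborel)
    = (\<integral>\<^sup>+x. ennreal (Gamma a * (indicator {0<..} x * (x * exp (- (s * x\<^sup>2)) * plane_R (2 * a) x))) \<partial>lborel)"
    using assms Gamma_real_pos[of a] by (intro nn_integral_ennreal_cmult[symmetric]) auto
  also have "\<dots> = (\<integral>\<^sup>+x. \<integral>\<^sup>+t. ennreal (?w x * (indicator {0<..} t * t powr (a - 1) * plane_E t x)) \<partial>lborel \<partial>lborel)"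
  proof (intro nn_integral_cong_AE eventually_mono[OF AE_lborel_singleton[of 1]])
    fix x :: real assume "x \<noteq> 1"
    show "ennreal (Gamma a * (indicator {0<..} x * (x * exp (- (s * x\<^sup>2)) * plane_R (2 * a) x))) = (\<integral>\<^sup>+t. ennreal (?w x * (indicator {0<..} t * t powr (a - 1) * plane_E t x)) \<partial>lborel)"
    proof (cases "0 < x")
      case True
      then have "(\<integral>\<^sup>+t. ennreal (?w x * (indicator {0<..} t * t powr (a - 1) * plane_E t x)) \<partial>lborel) = ennreal (?w x) * ennreal (Gamma a * plane_R (2 * a) x)"
        using plane_R_heat[OF assms(1), of x] \<open>x \<noteq> 1\<close> by (subst nn_integral_ennreal_cmult) auto
      also have "\<dots> = ennreal (?w x * (Gamma a * plane_R (2 * a) x))"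
        using True by (intro ennreal_mult'[symmetric]) auto
      finally show ?thesis by (simp add: mult_ac)
    qed simp
  qed
  also have "\<dots> = (\<integral>\<^sup>+t. \<integral>\<^sup>+x. ennreal (?w x * (indicator {0<..} t * t powr (a - 1) * plane_E t x)) \<partial>lborel \<partial>lborel)"
    by (rule nn_integral_ennreal_swap) measurable
  also have "\<dots> = (\<integral>\<^sup>+t. ennreal (pi / 2 * (indicator {0<..} t * (t powr (a - 1) / (s + t) * exp (- (s * t / (s + t)))))) \<partial>lborel)"
  proof (rule nn_integral_cong)
    fix t :: real
    show "(\<integral>\<^sup>+x. ennreal (?w x * (indicator {0<..} t * t powr (a - 1) * plane_E t x)) \<partial>lborel) = ennreal (pi / 2 * (indicator {0<..} t * (t powr (a - 1) / (s + t) * exp (- (s * t / (s + t))))))"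
    proof (cases "0 < t")
      case True
      have "(\<integral>\<^sup>+x. ennreal (?w x * (indicator {0<..} t * t powr (a - 1) * plane_E t x)) \<partial>lborel)
        = (\<integral>\<^sup>+x. ennreal (t powr (a - 1) * (indicator {0<..} x * (x * exp (- (s * x\<^sup>2)) * plane_E t x))) \<partial>lborel)"
        using True by (intro nn_integral_cong) (simp add: mult_ac)
      also have "\<dots> = ennreal (t powr (a - 1)) * ennreal (pi / (2 * (s + t)) * exp (- (s * t / (s + t))))"
        using nn_integral_two_gaussians[OF assms(2) True] by (subst nn_integral_ennreal_cmult) auto
      also have "\<dots> = ennreal (t powr (a - 1) * (pi / (2 * (s + t)) * exp (- (s * t / (s + t)))))"
        by (intro ennreal_mult'[symmetric]) auto
      finally show ?thesis using True by (simp add: mult_ac)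
    qed simp
  qed
  also have "\<dots> = ennreal (pi / 2) * (\<integral>\<^sup>+t. ennreal (indicator {0<..} t * (t powr (a - 1) / (s + t) * exp (- (s * t / (s + t))))) \<partial>lborel)"
    by (intro nn_integral_ennreal_cmult) auto
  finally show ?thesis .
qed

text \<open>Here both Gaussians are centred at the origin, so compared with
  \<open>nn_integral_gaussian_plane_R\<close> the factor \<open>exp (- (s * t / (s + t)))\<close>
  disappears.\<close>

lemma nn_integral_gaussian_powr:
  assumes "0 < a" "a < 1" "0 < s"
  shows "ennreal (Gamma a) * (\<integral>\<^sup>+x. ennreal (indicator {0<..} x * (x * exp (- (s * x\<^sup>2)) * (pi * x powr (- (2 * a))))) \<partial>lborel)
    = ennreal (pi / 2) * (\<integral>\<^sup>+t. ennreal (indicator {0<..} t * (t powr (a - 1) / (s + t))) \<partial>lborel)"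
proof -
  let ?w = "\<lambda>x. indicator {0<..} x * (x * exp (- (s * x\<^sup>2))) :: real"
  have "ennreal (Gamma a) * (\<integral>\<^sup>+x. ennreal (indicator {0<..} x * (x * exp (- (s * x\<^sup>2)) * (pi * x powr (- (2 * a))))) \<partial>lborel)
    = (\<integral>\<^sup>+x. ennreal (Gamma a * (indicator {0<..} x * (x * exp (- (s * x\<^sup>2)) * (pi * x powr (- (2 * a)))))) \<partial>lborel)"
    using assms Gamma_real_pos[of a] by (intro nn_integral_ennreal_cmult[symmetric]) auto
  also have "\<dots> = (\<integral>\<^sup>+x. \<integral>\<^sup>+t. ennreal (pi * ?w x * (indicator {0<..} t * (t powr (a - 1) * exp (- (x\<^sup>2 * t))))) \<partial>lborel \<partial>lborel)"
  proof (rule nn_integral_cong)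
    fix x :: real
    show "ennreal (Gamma a * (indicator {0<..} x * (x * exp (- (s * x\<^sup>2)) * (pi * x powr (- (2 * a)))))) = (\<integral>\<^sup>+t. ennreal (pi * ?w x * (indicator {0<..} t * (t powr (a - 1) * exp (- (x\<^sup>2 * t))))) \<partial>lborel)"
    proof (cases "0 < x")
      case True
      then have "(\<integral>\<^sup>+t. ennreal (pi * ?w x * (indicator {0<..} t * (t powr (a - 1) * exp (- (x\<^sup>2 * t))))) \<partial>lborel) = ennreal (pi * ?w x) * ennreal (Gamma a * (x\<^sup>2) powr (- a))"
        using nn_integral_powr_exp[OF assms(1), of "x\<^sup>2"] by (subst nn_integral_ennreal_cmult) auto
      also have "\<dots> = ennreal (pi * ?w x * (Gamma a * (x\<^sup>2) powr (- a)))"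
        using True by (intro ennreal_mult'[symmetric]) auto
      also have "(x\<^sup>2) powr (- a) = x powr (- (2 * a))"
      proof -
        have "x\<^sup>2 = x powr 2" using True by simp
        then show ?thesis by (simp only: powr_powr) simp
      qed
      finally show ?thesis by (simp add: mult_ac)
    qed simp
  qed
  also have "\<dots> = (\<integral>\<^sup>+t. \<integral>\<^sup>+x. ennreal (pi * ?w x * (indicator {0<..} t * (t powr (a - 1) * exp (- (x\<^sup>2 * t))))) \<partial>lborel \<partial>lborel)"
    by (rule nn_integral_ennreal_swap) measurable
  also have "\<dots> = (\<integral>\<^sup>+t. ennreal (pi / 2 * (indicator {0<..} t * (t powr (a - 1) / (s + t)))) \<partial>lborel)"
  proof (rule nn_integral_cong)
    fix t :: real
    show "(\<integral>\<^sup>+x. ennreal (pi * ?w x * (indicator {0<..} t * (t powr (a - 1) * exp (- (x\<^sup>2 * t))))) \<partial>lborel) = ennreal (pi / 2 * (indicator {0<..} t * (t powr (a - 1) / (s + t))))"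
    proof (cases "0 < t")
      case True
      have "(\<integral>\<^sup>+x. ennreal (pi * ?w x * (indicator {0<..} t * (t powr (a - 1) * exp (- (x\<^sup>2 * t))))) \<partial>lborel)
        = (\<integral>\<^sup>+x. ennreal (pi * t powr (a - 1) * (indicator {0<..} x * (x ^ (2 * 0 + 1) * exp (- ((s + t) * x\<^sup>2))))) \<partial>lborel)"
        using True by (intro nn_integral_cong) (simp add: algebra_simps exp_diff exp_minus divide_inverse)
      also have "\<dots> = ennreal (pi * t powr (a - 1)) * ennreal (fact 0 / (2 * (s + t) ^ (0 + 1)))"
        using True assms nn_integral_odd_gaussian[of "s + t" 0] by (subst nn_integral_ennreal_cmult) auto
      also have "\<dots> = ennreal (pi * t powr (a - 1) * (fact 0 / (2 * (s + t) ^ (0 + 1))))"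
        by (intro ennreal_mult'[symmetric]) auto
      finally show ?thesis using True by simp
    qed simp
  qed
  also have "\<dots> = ennreal (pi / 2) * (\<integral>\<^sup>+t. ennreal (indicator {0<..} t * (t powr (a - 1) / (s + t))) \<partial>lborel)"
    by (intro nn_integral_ennreal_cmult) auto
  finally show ?thesis .
qed

text \<open>The two terms of \<open>plane_H\<close> give \<open>?T\<close> and \<open>?S\<close> up
  to a common factor, and \<open>?T = ?S + ?D\<close> is used as a sum to avoid subtracting extended
  reals. All terms being finite, the equation passes to the reals. The sign is stated separately
  because \<open>ennreal\<close> sends negative numbers to 0, so the second claim alone would not
  determine the integral.\<close>

lemma gaussian_plane_H:
  assumes a: "0 < a" "a < 1/2" and s: "0 < s"
  shows "0 \<le> (\<integral>x. indicator {0<..} x * (x * exp (- (s * x\<^sup>2)) * plane_H (2 * a) x) \<partial>lborel)"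
    and "ennreal (\<integral>x. indicator {0<..} x * (x * exp (- (s * x\<^sup>2)) * plane_H (2 * a) x) \<partial>lborel)
      = ennreal (pi / (2 * Gamma a)) *
        (\<integral>\<^sup>+t. ennreal (indicator {0<..} t * (t powr (a - 1) / (s + t) * (1 - exp (- (s * t / (s + t)))))) \<partial>lborel)"
proof -
  define A where "A x = indicator {0<..} x * (x * exp (- (s * x\<^sup>2)) * (pi * x powr (- (2 * a))))" for x :: real
  define B where "B x = indicator {0<..} x * (x * exp (- (s * x\<^sup>2)) * plane_R (2 * a) x)" for x :: real
  have [measurable]: "A \<in> borel_measurable borel" "B \<in> borel_measurable borel"
    unfolding A_def B_def by measurable
  have nn: "0 \<le> A x" "0 \<le> B x" for x unfolding A_def B_def by (auto simp: indicator_def plane_R_nonneg)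
  let ?T = "\<integral>\<^sup>+t. ennreal (indicator {0<..} t * (t powr (a - 1) / (s + t))) \<partial>lborel"
  let ?S = "\<integral>\<^sup>+t. ennreal (indicator {0<..} t * (t powr (a - 1) / (s + t) * exp (- (s * t / (s + t))))) \<partial>lborel"
  let ?D = "\<integral>\<^sup>+t. ennreal (indicator {0<..} t * (t powr (a - 1) / (s + t) * (1 - exp (- (s * t / (s + t)))))) \<partial>lborel"
  have T: "?T = ?S + ?D"
  proof (subst nn_integral_add[symmetric])
    show "?T = (\<integral>\<^sup>+t. ennreal (indicator {0<..} t * (t powr (a - 1) / (s + t) * exp (- (s * t / (s + t))))) +
       ennreal (indicator {0<..} t * (t powr (a - 1) / (s + t) * (1 - exp (- (s * t / (s + t)))))) \<partial>lborel)"
    proof (rule nn_integral_cong)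
      fix t :: real
      have split: "ennreal k = ennreal (k * e) + ennreal (k * (1 - e))" if "0 \<le> k" "0 \<le> e" "e \<le> 1" for k e :: real
        using that by (subst ennreal_plus[symmetric]) (auto simp: algebra_simps mult_left_le_one_le)
      show "ennreal (indicator {0<..} t * (t powr (a - 1) / (s + t))) = ennreal (indicator {0<..} t * (t powr (a - 1) / (s + t) * exp (- (s * t / (s + t))))) +
       ennreal (indicator {0<..} t * (t powr (a - 1) / (s + t) * (1 - exp (- (s * t / (s + t))))))"
        using s split[of "t powr (a - 1) / (s + t)" "exp (- (s * t / (s + t)))"] by (cases "0 < t") simp_all
    qed
  qed auto
  \<comment> \<open>The exponent -1 of \<open>s + t\<close> is split as \<open>a + (1 - a)\<close>
    to recognise a Beta integral, finite because both parameters are positive.\<close>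
  have "?T = (\<integral>\<^sup>+t. ennreal (indicator {0<..} t * (t powr (a - 1) * (s + t) powr (- (a + (1 - a))))) \<partial>lborel)"
    using s by (intro nn_integral_cong) (simp add: indicator_def powr_minus divide_inverse)
  also have "\<dots> < \<infinity>"
    using a s by (subst nn_integral_powr_over_add) auto
  finally have fin: "?T < \<infinity>" .
  have G: "0 < Gamma a" using a by simp
  let ?c = "ennreal (pi / (2 * Gamma a))"
  have c: "ennreal (1 / Gamma a) * ennreal (pi / 2) = ?c" "ennreal (1 / Gamma a) * ennreal (Gamma a) = 1"
    using G by (simp_all add: ennreal_mult'[symmetric] mult.commute)
  have cancel: "K = ?c * L" if "ennreal (Gamma a) * K = ennreal (pi / 2) * L" for K L
  proof -
    have "K = ennreal (1 / Gamma a) * (ennreal (Gamma a) * K)" by (simp add: c(2) flip: mult.assoc)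
    also have "\<dots> = ?c * L" unfolding that by (simp add: c(1) flip: mult.assoc)
    finally show ?thesis .
  qed
  have A: "(\<integral>\<^sup>+x. A x \<partial>lborel) = ?c * ?T"
    unfolding A_def using a s by (intro cancel nn_integral_gaussian_powr) auto
  have B: "(\<integral>\<^sup>+x. B x \<partial>lborel) = ?c * ?S"
    unfolding B_def using a s by (intro cancel nn_integral_gaussian_plane_R) auto
  have AB: "(\<integral>\<^sup>+x. A x \<partial>lborel) = (\<integral>\<^sup>+x. B x \<partial>lborel) + ?c * ?D"
    unfolding A B T by (rule distrib_left)
  have finA: "(\<integral>\<^sup>+x. A x \<partial>lborel) < \<infinity>" unfolding A using fin by (simp add: ennreal_mult_less_top)
  then have finB: "(\<integral>\<^sup>+x. B x \<partial>lborel) < \<infinity>" and finD: "?c * ?D < \<infinity>" unfolding AB by auto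
  have int: "integrable lborel A" "integrable lborel B"
    using finA finB nn by (auto intro!: integrableI_nonneg)
  obtain d where d: "0 \<le> d" "?c * ?D = ennreal d"
    using finD by (cases "?c * ?D") auto
  have e: "ennreal (integral\<^sup>L lborel A) = ennreal (integral\<^sup>L lborel B) + ennreal d"
    using AB unfolding nn_integral_eq_integral[OF int(1) AE_I2[OF nn(1)]] nn_integral_eq_integral[OF int(2) AE_I2[OF nn(2)]] d(2) .
  have "integral\<^sup>L lborel A = integral\<^sup>L lborel B + d"
  proof -
    have nonneg: "0 \<le> integral\<^sup>L lborel A" "0 \<le> integral\<^sup>L lborel B"
      using nn by (auto intro!: integral_nonneg_AE)
    then have "ennreal (integral\<^sup>L lborel A) = ennreal (integral\<^sup>L lborel B + d)"
      using e d(1) by (simp only: ennreal_plus)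
    then show ?thesis using nonneg d(1) by (subst (asm) ennreal_inj) auto
  qed
  moreover have "(\<integral>x. indicator {0<..} x * (x * exp (- (s * x\<^sup>2)) * plane_H (2 * a) x) \<partial>lborel) = (\<integral>x. A x - B x \<partial>lborel)"
  proof (intro integral_cong_AE eventually_mono[OF AE_lborel_singleton[of 1]])
    fix x :: real assume "x \<noteq> 1"
    then show "indicator {0<..} x * (x * exp (- (s * x\<^sup>2)) * plane_H (2 * a) x) = A x - B x"
      by (cases "0 < x") (simp_all add: A_def B_def plane_H_eq right_diff_distrib)
  qed auto
  ultimately have I: "(\<integral>x. indicator {0<..} x * (x * exp (- (s * x\<^sup>2)) * plane_H (2 * a) x) \<partial>lborel) = d"
    using int by simp
  show "0 \<le> (\<integral>x. indicator {0<..} x * (x * exp (- (s * x\<^sup>2)) * plane_H (2 * a) x) \<partial>lborel)"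
    unfolding I by (fact d)
  show "ennreal (\<integral>x. indicator {0<..} x * (x * exp (- (s * x\<^sup>2)) * plane_H (2 * a) x) \<partial>lborel) = ?c * ?D"
    unfolding I d ..
qed

text \<open>The factor \<open>x powr (- q)\<close> contained in \<open>x powr (1 - q)\<close> is
  written as a Gamma integral in \<open>s\<close>. This and the representation of
  \<open>plane_H\<close> each contribute one \<open>Gamma (q / 2)\<close> to the denominator. The
  integrability hypothesis is supplied later by dominated convergence on the sphere.\<close>

lemma LBINT_plane_H:
  assumes q: "0 < q" "q < 1"
    and int: "integrable lborel (\<lambda>x. indicator {0<..} x * (x powr (1 - q) * plane_H q x))"
  shows "(\<integral>x. indicator {0<..} x * (x powr (1 - q) * plane_H q x) \<partial>lborel)
    = pi / (2 * (1 - q)\<^sup>2) * ((Gamma (1 - q / 2))\<^sup>2 * Gamma q / ((Gamma (q / 2))\<^sup>2 * Gamma (1 - q)))"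
proof -
  define a where "a = q / 2"
  have a: "0 < a" "a < 1/2" "q = 2 * a" using q by (auto simp: a_def)
  have G: "0 < Gamma a" using a by simp
  define f where "f x s = indicator {0<..} s * (s powr (a - 1) * exp (- (x\<^sup>2 * s))) * (indicator {0<..} x * (x * plane_H q x))" for x s :: real
  have [measurable]: "case_prod f \<in> borel_measurable (lborel \<Otimes>\<^sub>M lborel)"
    unfolding f_def by measurable
  have kern: "has_bochner_integral lborel (\<lambda>s. indicator {0<..} s * (s powr (a - 1) * exp (- (x\<^sup>2 * s)))) (Gamma a * x powr (- q))" if "0 < x" for x
  proof (rule has_bochner_integral_nn_integral)
    have "(x\<^sup>2) powr (- a) = x powr (- q)"
    proof -
      have "x\<^sup>2 = x powr 2" using that by simp
      then show ?thesis unfolding a(3) by (simp only: powr_powr) simp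
    qed
    then show "(\<integral>\<^sup>+s. ennreal (indicator {0<..} s * (s powr (a - 1) * exp (- (x\<^sup>2 * s)))) \<partial>lborel) = ennreal (Gamma a * x powr (- q))"
      using nn_integral_powr_exp[OF a(1), of "x\<^sup>2"] that by simp
  qed (use G in \<open>auto simp: indicator_def\<close>)
  have xq: "x * x powr (- q) = x powr (1 - q)" if "0 < x" for x :: real
    using powr_mult_base[of x "- q"] that by simp
  have f1: "integrable lborel (f x)" "(\<integral>s. f x s \<partial>lborel) = Gamma a * (indicator {0<..} x * (x powr (1 - q) * plane_H q x))" for x
  proof -
    have "integrable lborel (f x) \<and> (\<integral>s. f x s \<partial>lborel) = Gamma a * (indicator {0<..} x * (x powr (1 - q) * plane_H q x))"
    proof (cases "0 < x")
      case True
      then show ?thesis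
        using has_bochner_integral_mult_left[OF kern[OF True], of "x * plane_H q x"] xq[OF True, symmetric]
        by (auto simp: f_def[abs_def] has_bochner_integral_iff)
    qed (simp add: f_def[abs_def])
    then show "integrable lborel (f x)" "(\<integral>s. f x s \<partial>lborel) = Gamma a * (indicator {0<..} x * (x powr (1 - q) * plane_H q x))" by auto
  qed
  have nf: "(\<integral>s. norm (f x s) \<partial>lborel) = Gamma a * norm (indicator {0<..} x * (x powr (1 - q) * plane_H q x))" for x
  proof (cases "0 < x")
    case True
    have "(\<integral>s. norm (f x s) \<partial>lborel) = (\<integral>s. indicator {0<..} s * (s powr (a - 1) * exp (- (x\<^sup>2 * s))) * (x * \<bar>plane_H q x\<bar>) \<partial>lborel)"
      using True by (intro Bochner_Integration.integral_cong) (auto simp: f_def abs_mult indicator_def)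
    also have "\<dots> = Gamma a * x powr (- q) * (x * \<bar>plane_H q x\<bar>)"
      using has_bochner_integral_mult_left[OF kern[OF True], of "x * \<bar>plane_H q x\<bar>"] by (auto simp: has_bochner_integral_iff)
    finally show ?thesis using True xq[OF True, symmetric] by (simp add: abs_mult)
  qed (simp add: f_def[abs_def])
  \<comment> \<open>Absolute integrability holds only because the angle has already been integrated out.\<close>
  have pint: "integrable (lborel \<Otimes>\<^sub>M lborel) (case_prod f)"
  proof (rule lborel_pair.Fubini_integrable)
    show "integrable lborel (\<lambda>x. \<integral>y. norm (case (x, y) of (x, y) \<Rightarrow> f x y) \<partial>lborel)"
      unfolding split nf by (intro integrable_mult_right integrable_norm int)
  qed (use f1 in auto)
  define U where "U s = indicator {0<..} s * s powr (a - 1) * (\<integral>x. indicator {0<..} x * (x * exp (- (s * x\<^sup>2)) * plane_H (2 * a) x) \<partial>lborel)" for s :: real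
  have U_eq: "(\<integral>x. f x s \<partial>lborel) = U s" for s
    unfolding U_def by (subst integral_mult_right_zero[symmetric], rule Bochner_Integration.integral_cong)
      (auto simp: f_def a(3) mult_ac)
  have [measurable]: "U \<in> borel_measurable lborel"
    unfolding U_eq[symmetric, abs_def] by measurable
  \<comment> \<open>Although \<open>plane_H\<close> changes sign, its Gaussian averages do not, so
    the outer integral can be evaluated with extended reals.\<close>
  have U_nonneg: "0 \<le> U s" for s
    unfolding U_def using gaussian_plane_H(1)[OF a(1,2), of s] by (simp add: indicator_def)
  let ?V = "Gamma (2 * a) / (1 - 2 * a) * ((Gamma (1 - a))\<^sup>2 / Gamma (2 - 2 * a))"
  have "Gamma a * (\<integral>x. indicator {0<..} x * (x powr (1 - q) * plane_H q x) \<partial>lborel) = (\<integral>x. (\<integral>s. f x s \<partial>lborel) \<partial>lborel)"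
    by (simp add: f1)
  also have "\<dots> = (\<integral>s. (\<integral>x. f x s \<partial>lborel) \<partial>lborel)"
    by (rule lborel_pair.Fubini_integral[symmetric]) (fact pint)
  also have "\<dots> = enn2real (\<integral>\<^sup>+s. ennreal (U s) \<partial>lborel)"
    unfolding U_eq using U_nonneg by (intro integral_eq_nn_integral) auto
  also have "(\<integral>\<^sup>+s. ennreal (U s) \<partial>lborel) = (\<integral>\<^sup>+s. ennreal (pi / (2 * Gamma a)) * (ennreal (indicator {0<..} s * s powr (a - 1)) *
        (\<integral>\<^sup>+t. ennreal (indicator {0<..} t * (t powr (a - 1) / (s + t) * (1 - exp (- (s * t / (s + t)))))) \<partial>lborel)) \<partial>lborel)"
  proof (rule nn_integral_cong)
    fix s :: real
    show "ennreal (U s) = ennreal (pi / (2 * Gamma a)) * (ennreal (indicator {0<..} s * s powr (a - 1)) *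
        (\<integral>\<^sup>+t. ennreal (indicator {0<..} t * (t powr (a - 1) / (s + t) * (1 - exp (- (s * t / (s + t)))))) \<partial>lborel))"
    proof (cases "0 < s")
      case True
      have "ennreal (U s) = ennreal (indicator {0<..} s * s powr (a - 1)) * ennreal (\<integral>x. indicator {0<..} x * (x * exp (- (s * x\<^sup>2)) * plane_H (2 * a) x) \<partial>lborel)"
        unfolding U_def by (rule ennreal_mult') simp
      then show ?thesis unfolding gaussian_plane_H(2)[OF a(1,2) True] by (simp only: mult_ac)
    qed (simp add: U_def)
  qed
  also have "\<dots> = ennreal (pi / (2 * Gamma a)) * ennreal ?V"
    unfolding nn_integral_heat_kernel[OF a(1,2), symmetric] by (rule nn_integral_cmult) measurable
  also have "\<dots> = ennreal (pi / (2 * Gamma a) * ?V)"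
    using G by (intro ennreal_mult'[symmetric]) auto
  also have "enn2real \<dots> = pi / (2 * Gamma a) * ?V"
    using a G Gamma_real_pos[of "2 * a"] Gamma_real_pos[of "2 - 2 * a"] by (intro enn2real_ennreal mult_nonneg_nonneg divide_nonneg_nonneg) auto
  finally have "Gamma a * (\<integral>x. indicator {0<..} x * (x powr (1 - q) * plane_H q x) \<partial>lborel) = pi / (2 * Gamma a) * ?V" .
  moreover have "y = z / g" if "g * y = z" "0 < g" for y z g :: real
    using that by auto
  ultimately have "(\<integral>x. indicator {0<..} x * (x powr (1 - q) * plane_H q x) \<partial>lborel) = pi / (2 * Gamma a) * ?V / Gamma a"
    using G by blast
  \<comment> \<open>This supplies the second factor \<open>1 - q\<close> in the denominator; the
    first stems from the Gamma integral with \<open>1 - exp\<close>.\<close>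
  moreover have "Gamma (2 - 2 * a) = (1 - q) * Gamma (1 - q)"
  proof -
    have "1 - q \<notin> \<int>\<^sub>\<le>\<^sub>0" using q nonpos_Ints_nonpos[of "1 - q"] by auto
    from Gamma_plus1[OF this] show ?thesis unfolding a(3) by (simp add: algebra_simps)
  qed
  ultimately show ?thesis
    unfolding a(3) by (simp add: power2_eq_square mult_ac)
qed

subsection \<open>Geodesic distance on the sphere\<close>

text \<open>\<open>sph_t\<close> is the inner product of the unit vectors \<open>(sin \<theta> cos
  \<phi>, sin \<theta> sin \<phi>, cos \<theta>)\<close> and \<open>(sin l, 0, cos l)\<close>. The
  right side is the squared length of the component of the first orthogonal to the second.\<close>

lemma one_minus_sph_t_sq:
  "1 - (sph_t \<theta> l \<phi>)\<^sup>2 = (sin \<theta> * sin \<phi>)\<^sup>2 + (cos l * sin \<theta> * cos \<phi> - sin l * cos \<theta>)\<^sup>2"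
proof -
  have "(sin \<theta>)\<^sup>2 + (cos \<theta>)\<^sup>2 = 1" "(sin l)\<^sup>2 + (cos l)\<^sup>2 = 1" "(sin \<phi>)\<^sup>2 + (cos \<phi>)\<^sup>2 = 1"
    by simp_all
  then show ?thesis unfolding sph_t_def by algebra
qed

lemma abs_sph_t_le_1: "\<bar>sph_t \<theta> l \<phi>\<bar> \<le> 1"
proof -
  have "0 \<le> 1 - (sph_t \<theta> l \<phi>)\<^sup>2" unfolding one_minus_sph_t_sq by simp
  then show ?thesis by (simp add: abs_square_le_1)
qed

lemma sph_t_bounds: "- 1 \<le> sph_t \<theta> l \<phi>" "sph_t \<theta> l \<phi> \<le> 1"
  using abs_sph_t_le_1[of \<theta> l \<phi>] by auto

lemma sph_a_bounds: "0 \<le> sph_a \<theta> l \<phi>" "sph_a \<theta> l \<phi> \<le> pi"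
  using sph_t_bounds unfolding sph_a_def by (auto intro: arccos_lbound arccos_ubound)

lemma cos_sph_a [simp]: "cos (sph_a \<theta> l \<phi>) = sph_t \<theta> l \<phi>"
  using sph_t_bounds by (simp add: sph_a_def)

text \<open>A lower bound that does not involve \<open>l\<close>, hence usable uniformly near
  \<open>l = \<theta>\<close>, where the distance can vanish.\<close>

lemma sph_a_ge_sin_sin: "sin \<theta> * sin \<phi> \<le> sph_a \<theta> l \<phi>"
proof -
  have "sin \<theta> * sin \<phi> \<le> sqrt (1 - (sph_t \<theta> l \<phi>)\<^sup>2)"
    unfolding one_minus_sph_t_sq by (rule real_le_rsqrt) simp
  also have "\<dots> = sin (sph_a \<theta> l \<phi>)"
    using sph_t_bounds by (simp add: sph_a_def sin_arccos)
  also have "\<dots> \<le> sph_a \<theta> l \<phi>" using sph_a_bounds by (intro sin_x_le_x)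
  finally show ?thesis .
qed

text \<open>The spherical triangle inequality for two points at distances \<open>\<theta>\<close>
  and \<open>l\<close> from the pole: \<open>cos \<phi>\<close> lies between -1 and 1, and the
  cosine decreases on \<open>{0..pi}\<close>. If \<open>l + \<theta>\<close> exceeds pi, the upper
  bound is trivial.\<close>

lemma abs_sph_a_minus_le:
  assumes "0 \<le> \<theta>" "\<theta> \<le> pi" "0 \<le> l" "l \<le> pi"
  shows "\<bar>sph_a \<theta> l \<phi> - l\<bar> \<le> \<theta>" "\<bar>l - \<theta>\<bar> \<le> sph_a \<theta> l \<phi>"
proof -
  have ss: "0 \<le> sin \<theta> * sin l" using assms by (intro mult_nonneg_nonneg sin_ge_zero)
  have "sph_t \<theta> l \<phi> \<le> cos \<bar>l - \<theta>\<bar>"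
    using mult_left_mono[OF cos_le_one[of \<phi>] ss] by (simp add: sph_t_def cos_diff mult_ac)
  then have "cos (sph_a \<theta> l \<phi>) \<le> cos \<bar>l - \<theta>\<bar>" by simp
  then show *: "\<bar>l - \<theta>\<bar> \<le> sph_a \<theta> l \<phi>"
    using assms sph_a_bounds[of \<theta> l \<phi>] by (subst (asm) cos_mono_le_eq) auto
  have "sph_a \<theta> l \<phi> \<le> l + \<theta>"
  proof (cases "l + \<theta> \<le> pi")
    case True
    have "cos (l + \<theta>) \<le> sph_t \<theta> l \<phi>"
      using mult_left_mono[OF cos_ge_minus_one[of \<phi>] ss] by (simp add: sph_t_def cos_add mult_ac)
    then have "cos (l + \<theta>) \<le> cos (sph_a \<theta> l \<phi>)" by simp
    then show ?thesis
      using True assms sph_a_bounds[of \<theta> l \<phi>] by (subst (asm) cos_mono_le_eq) auto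
  qed (use sph_a_bounds[of \<theta> l \<phi>] in linarith)
  with * show "\<bar>sph_a \<theta> l \<phi> - l\<bar> \<le> \<theta>" by linarith
qed

lemma continuous_on_sph_a: "continuous_on A (\<lambda>p. sph_a \<theta> (fst p) (snd p))"
  using sph_t_bounds unfolding sph_a_def sph_t_def
  by (auto intro!: continuous_intros)

lemma sph_a_measurable [measurable]: "(\<lambda>p. sph_a \<theta> (fst p) (snd p)) \<in> borel_measurable borel"
  by (rule borel_measurable_continuous_onI) (rule continuous_on_sph_a)

definition sph_H :: "real \<Rightarrow> real \<Rightarrow> real \<Rightarrow> real" where
  "sph_H q \<theta> l = (LBINT \<phi>:{0..pi}. (l powr (- q) - sph_a \<theta> l \<phi> powr (- q)))"

lemma continuous_on_sph_a_snd: "continuous_on A (sph_a \<theta> l)"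
  using continuous_on_compose[of A "\<lambda>\<phi>. (l, \<phi>)", OF _ continuous_on_sph_a[of _ \<theta>]]
  by (simp add: comp_def continuous_on_Pair)

lemma set_integrable_sph_a: "set_integrable lborel {0..pi} (\<lambda>\<phi>. sph_a \<theta> l \<phi>)"
  by (intro borel_integrable_atLeastAtMost' continuous_on_sph_a_snd)

text \<open>
  Expanding \<open>cos a\<close> rather than \<open>a\<close> around \<open>l\<close> avoids the singularity of \<open>a\<close> at the antipode, where
  \<open>sin l\<close> vanishes.
\<close>

lemma sph_a_first_moment:
  assumes "0 \<le> \<theta>" "\<theta> \<le> pi" "0 \<le> l" "l \<le> pi"
  shows "\<bar>sin l * (LBINT \<phi>:{0..pi}. sph_a \<theta> l \<phi> - l)\<bar> \<le> pi * \<theta>\<^sup>2"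
proof -
  \<comment> \<open>The added cosine term has integral zero, so it leaves the integral unchanged,
    while it cancels the first-order part and makes \<open>?r\<close> of order
    \<open>\<theta>^2\<close> pointwise.\<close>
  let ?r = "\<lambda>\<phi>. sin l * (sph_a \<theta> l \<phi> - l) + sin \<theta> * sin l * cos \<phi>"
  have cint: "set_integrable lborel {0..pi} (\<lambda>\<phi>. sin \<theta> * sin l * cos \<phi>)"
    by (intro borel_integrable_atLeastAtMost' continuous_intros)
  have aint: "set_integrable lborel {0..pi} (\<lambda>\<phi>. sin l * (sph_a \<theta> l \<phi> - l))"
    by (intro set_integrable_mult_right set_integral_diff set_integrable_sph_a borel_integrable_atLeastAtMost' continuous_intros)
  have rb: "\<bar>?r \<phi>\<bar> \<le> \<theta>\<^sup>2" for \<phi>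
  proof -
    have "\<bar>cos \<theta> - 1\<bar> \<le> \<theta>\<^sup>2 / 2" using cos_second_order[of \<theta> 0] by simp
    then have 1: "\<bar>cos l * (cos \<theta> - 1)\<bar> \<le> \<theta>\<^sup>2 / 2"
      unfolding abs_mult using mult_mono[of "\<bar>cos l\<bar>" 1 "\<bar>cos \<theta> - 1\<bar>" "\<theta>\<^sup>2 / 2"] by simp
    have "(sph_a \<theta> l \<phi> - l)\<^sup>2 \<le> \<theta>\<^sup>2"
      using abs_sph_a_minus_le(1)[OF assms] assms by (intro abs_le_square_iff[THEN iffD1]) auto
    then have "\<bar>sph_t \<theta> l \<phi> - cos l + sin l * (sph_a \<theta> l \<phi> - l)\<bar> \<le> \<theta>\<^sup>2 / 2"
      using cos_second_order[of "sph_a \<theta> l \<phi>" l] by simp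
    then have "\<bar>sph_t \<theta> l \<phi> - cos l + sin l * (sph_a \<theta> l \<phi> - l) - cos l * (cos \<theta> - 1)\<bar> \<le> \<theta>\<^sup>2"
      using 1 unfolding abs_le_iff by linarith
    then show ?thesis unfolding sph_t_def by (simp add: algebra_simps)
  qed
  have "sin l * (LBINT \<phi>:{0..pi}. sph_a \<theta> l \<phi> - l) = (LBINT \<phi>:{0..pi}. ?r \<phi>)"
    using aint cint by (simp add: set_integral_add LBINT_cos_0_pi)
  also have "\<bar>\<dots>\<bar> \<le> pi * \<theta>\<^sup>2"
    using abs_LBINT_Icc_le[OF _ set_integral_add(1)[OF aint cint] rb] by simp
  finally show ?thesis .
qed

lemma set_integrable_powr_sph_a:
  assumes "0 \<le> \<theta>" "\<theta> \<le> pi" "0 \<le> l" "l \<le> pi" "l \<noteq> \<theta>"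
  shows "set_integrable lborel {0..pi} (\<lambda>\<phi>. sph_a \<theta> l \<phi> powr p)"
proof (rule borel_integrable_atLeastAtMost')
  have "0 < sph_a \<theta> l \<phi>" for \<phi> using abs_sph_a_minus_le(2)[OF assms(1-4), of \<phi>] assms(5) by linarith
  then show "continuous_on {0..pi} (\<lambda>\<phi>. sph_a \<theta> l \<phi> powr p)"
    by (intro continuous_on_powr continuous_on_sph_a_snd continuous_intros) (auto simp: less_imp_neq[symmetric])
qed

text \<open>The linear Taylor term of the power is controlled by \<open>sph_a_first_moment\<close>,
  which absorbs the weight \<open>sin l\<close>; in the quadratic remainder
  \<open>sin l \<le> l\<close> gains back one power of \<open>l\<close>. The condition
  \<open>2 * \<theta> \<le> l\<close> ensures \<open>a \<ge> l / 2\<close>, and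
  \<open>2 powr (q + 1)\<close> is half of the factor \<open>2 powr (q + 2)\<close> from
  \<open>(l / 2) powr (- q - 2)\<close>.\<close>

lemma sph_H_bound:
  assumes q: "0 < q" and th: "0 < \<theta>" "\<theta> \<le> pi" and l: "2 * \<theta> \<le> l" "l \<le> pi"
  shows "\<bar>sph_H q \<theta> l\<bar> * sin l \<le> pi * (q + q * (q + 1) * 2 powr (q + 1)) * \<theta>\<^sup>2 * l powr (- q - 1)"
proof -
  let ?B = "q * (q + 1) / 2 * (l / 2) powr (- q - 2) * \<theta>\<^sup>2"
  have l0: "0 < l" "0 \<le> sin l" "sin l \<le> l" and lth: "l \<noteq> \<theta>" using th l by (auto intro: sin_ge_zero sin_x_le_x)
  define r where "r \<phi> = l powr (- q) - sph_a \<theta> l \<phi> powr (- q) - q * l powr (- q - 1) * (sph_a \<theta> l \<phi> - l)" for \<phi>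
  have rb: "\<bar>r \<phi>\<bar> \<le> ?B" for \<phi>
  proof -
    have *: "\<bar>sph_a \<theta> l \<phi> - l\<bar> \<le> \<theta>" using th l by (intro abs_sph_a_minus_le(1)) auto
    then have "l / 2 \<le> sph_a \<theta> l \<phi>" using l unfolding abs_le_iff by linarith
    then have "\<bar>r \<phi>\<bar> \<le> q * (q + 1) / 2 * (l / 2) powr (- q - 2) * (sph_a \<theta> l \<phi> - l)\<^sup>2"
      using powr_second_order[OF q l0(1), of "sph_a \<theta> l \<phi>"] unfolding r_def by (subst abs_minus_commute) (simp add: algebra_simps)
    also have "\<dots> \<le> ?B"
      using * th q by (intro mult_left_mono abs_le_square_iff[THEN iffD1]) auto
    finally show ?thesis .
  qed
  have i0: "set_integrable lborel {0..pi} (\<lambda>\<phi>. c)" for c :: real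
    by (intro borel_integrable_atLeastAtMost' continuous_intros)
  have i1: "set_integrable lborel {0..pi} (\<lambda>\<phi>. l powr (- q) - sph_a \<theta> l \<phi> powr (- q))"
    using th l lth by (intro set_integral_diff i0 set_integrable_powr_sph_a) auto
  have i2: "set_integrable lborel {0..pi} (\<lambda>\<phi>. sph_a \<theta> l \<phi> - l)"
    by (intro set_integral_diff i0 set_integrable_sph_a)
  have i3: "set_integrable lborel {0..pi} r"
    unfolding r_def by (intro set_integral_diff(1) i1 set_integrable_mult_right i2)
  have "sph_H q \<theta> l = q * l powr (- q - 1) * (LBINT \<phi>:{0..pi}. sph_a \<theta> l \<phi> - l) + (LBINT \<phi>:{0..pi}. r \<phi>)"
    unfolding sph_H_def r_def by (subst set_integral_diff(2)[OF i1 set_integrable_mult_right[OF i2]]) simp_all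
  then have "\<bar>sph_H q \<theta> l\<bar> * sin l \<le> (\<bar>q * l powr (- q - 1) * (LBINT \<phi>:{0..pi}. sph_a \<theta> l \<phi> - l)\<bar> + \<bar>LBINT \<phi>:{0..pi}. r \<phi>\<bar>) * sin l"
    using l0 by (intro mult_right_mono) (auto intro: abs_triangle_ineq)
  also have "\<dots> = q * l powr (- q - 1) * \<bar>sin l * (LBINT \<phi>:{0..pi}. sph_a \<theta> l \<phi> - l)\<bar> + \<bar>LBINT \<phi>:{0..pi}. r \<phi>\<bar> * sin l"
    using l0 q by (simp add: abs_mult algebra_simps)
  also have "\<dots> \<le> q * l powr (- q - 1) * (pi * \<theta>\<^sup>2) + (pi * ?B) * l"
  proof (intro add_mono mult_left_mono mult_mono)
    show "\<bar>LBINT \<phi>:{0..pi}. r \<phi>\<bar> \<le> pi * ?B"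
      using abs_LBINT_Icc_le[OF _ i3 rb] by simp
  qed (use q th l l0 in \<open>auto intro!: sph_a_first_moment\<close>)
  also have "\<dots> = pi * (q + q * (q + 1) * 2 powr (q + 1)) * \<theta>\<^sup>2 * l powr (- q - 1)"
  proof -
    have "(l / 2) powr (- q - 2) = l powr (- q - 2) * 2 powr (q + 2)"
      using powr_minus_divide[of "2::real" "q + 2"] by (simp add: powr_divide)
    moreover have "l powr (- q - 1) = l powr (- q - 2) * l"
    proof -
      have "1 + (- q - 2) = - q - 1" by simp
      then show ?thesis using l0 powr_mult_base[of l "- q - 2"] by (simp only: mult.commute)
    qed
    moreover have "(2::real) powr (q + 2) = 2 powr (q + 1) * 2" by (simp add: powr_add)
    ultimately have *: "(l / 2) powr (- q - 2) = l powr (- q - 2) * (2 powr (q + 1) * 2)"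
      "l powr (- q - 1) = l powr (- q - 2) * l" by simp_all
    show ?thesis unfolding * by (simp add: algebra_simps)
  qed
  finally show ?thesis .
qed

subsection \<open>Passage to the limit\<close>

definition scaled_H :: "real \<Rightarrow> real \<Rightarrow> real \<Rightarrow> real" where
  "scaled_H q \<theta> x = (LBINT \<phi>:{0..pi}. (x powr (- q) - (sph_a \<theta> (\<theta> * x) \<phi> / \<theta>) powr (- q)))"

lemma sph_H_scaled:
  assumes "0 < \<theta>" "0 \<le> x"
  shows "sph_H q \<theta> (\<theta> * x) = \<theta> powr (- q) * scaled_H q \<theta> x"
proof -
  have "(\<theta> * x) powr (- q) - sph_a \<theta> (\<theta> * x) \<phi> powr (- q)
    = \<theta> powr (- q) * (x powr (- q) - (sph_a \<theta> (\<theta> * x) \<phi> / \<theta>) powr (- q))" for \<phi>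
    using assms by (simp add: powr_mult powr_divide right_diff_distrib)
  then show ?thesis unfolding sph_H_def scaled_H_def by simp
qed

text \<open>The arccosine is not differentiable at 1, so \<open>a\<close> is not expanded directly.
  Instead \<open>1 - cos a\<close> is compared with \<open>a^2\<close> on one side and with
  \<open>\<theta>^2\<close> on the other, and the quotient of the two limits is taken.\<close>

lemma tendsto_sph_a_over:
  assumes x: "0 < x" "x \<noteq> 1"
  shows "((\<lambda>\<theta>. (sph_a \<theta> (\<theta> * x) \<phi> / \<theta>)\<^sup>2) \<longlongrightarrow> x\<^sup>2 + 1 - 2 * x * cos \<phi>) (at_right 0)"
proof -
  let ?a = "\<lambda>\<theta>. sph_a \<theta> (\<theta> * x) \<phi>"
  \<comment> \<open>Below this bound \<open>\<theta> + \<theta> * x < pi\<close>, so both distances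
    from the pole are admissible in the triangle inequality.\<close>
  let ?b = "pi / (x + 1)"
  have ev: "eventually (\<lambda>\<theta>. \<theta> \<in> {0<..<?b}) (at_right (0::real))"
    using x by (intro eventually_at_right_real) auto
  have dom: "0 \<le> \<theta>" "\<theta> \<le> pi" "0 \<le> \<theta> * x" "\<theta> * x \<le> pi" if "\<theta> \<in> {0<..<?b}" for \<theta>
  proof -
    have "\<theta> * (x + 1) < pi" using that x by (simp add: field_simps)
    moreover have "0 < \<theta>" using that by simp
    ultimately show "0 \<le> \<theta>" "\<theta> \<le> pi" "0 \<le> \<theta> * x" "\<theta> * x \<le> pi"
      using x by (auto simp: distrib_left intro: add_mono order.trans[of _ "\<theta> * x + \<theta>"])
  qed
  have pos: "0 < ?a \<theta>" "?a \<theta> \<le> \<theta> * (x + 1)" if t: "\<theta> \<in> {0<..<?b}" for \<theta>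
  proof -
    have "0 < \<bar>\<theta> * x - \<theta>\<bar>" using t x by auto
    then show "0 < ?a \<theta>" using abs_sph_a_minus_le(2)[OF dom[OF t], of \<phi>] by linarith
    show "?a \<theta> \<le> \<theta> * (x + 1)" using abs_sph_a_minus_le(1)[OF dom[OF t], of \<phi>] by (simp add: algebra_simps abs_le_iff)
  qed
  have a0: "filterlim ?a (at_right 0) (at_right 0)"
    unfolding filterlim_at
  proof
    show "eventually (\<lambda>\<theta>. ?a \<theta> \<in> {0<..} \<and> ?a \<theta> \<noteq> 0) (at_right 0)"
      using ev by eventually_elim (use pos in force)
    show "(?a \<longlongrightarrow> 0) (at_right 0)"
    proof (rule tendsto_sandwich)
      show "eventually (\<lambda>\<theta>. 0 \<le> ?a \<theta>) (at_right 0)" by (simp add: sph_a_bounds)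
      show "eventually (\<lambda>\<theta>. ?a \<theta> \<le> \<theta> * (x + 1)) (at_right 0)"
        using ev by eventually_elim (use pos in blast)
      show "((\<lambda>\<theta>. \<theta> * (x + 1)) \<longlongrightarrow> 0) (at_right 0)" by real_asymp
    qed simp
  qed
  have "((\<lambda>y::real. (1 - cos y) / y\<^sup>2) \<longlongrightarrow> 1 / 2) (at_right 0)" by real_asymp
  from filterlim_compose[OF this a0]
  have 1: "((\<lambda>\<theta>. (1 - sph_t \<theta> (\<theta> * x) \<phi>) / (?a \<theta>)\<^sup>2) \<longlongrightarrow> 1 / 2) (at_right 0)" by simp
  have 2: "((\<lambda>\<theta>. (1 - (sin \<theta> * sin (\<theta> * x) * c + cos \<theta> * cos (\<theta> * x))) / \<theta>\<^sup>2) \<longlongrightarrow> (x\<^sup>2 + 1 - 2 * x * c) / 2) (at_right 0)" for c :: real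
    by real_asymp (simp add: power2_eq_square field_simps)
  have half: "z / 2 / (1 / 2) = z" for z :: real by simp
  have "((\<lambda>\<theta>. ((1 - sph_t \<theta> (\<theta> * x) \<phi>) / \<theta>\<^sup>2) / ((1 - sph_t \<theta> (\<theta> * x) \<phi>) / (?a \<theta>)\<^sup>2)) \<longlongrightarrow> ((x\<^sup>2 + 1 - 2 * x * cos \<phi>) / 2) / (1 / 2)) (at_right 0)"
    by (rule tendsto_divide[OF _ 1]) (use 2[of "cos \<phi>"] in \<open>simp_all add: sph_t_def\<close>)
  then have lim: "((\<lambda>\<theta>. ((1 - sph_t \<theta> (\<theta> * x) \<phi>) / \<theta>\<^sup>2) / ((1 - sph_t \<theta> (\<theta> * x) \<phi>) / (?a \<theta>)\<^sup>2)) \<longlongrightarrow> x\<^sup>2 + 1 - 2 * x * cos \<phi>) (at_right 0)"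
    by (simp only: half)
  have "eventually (\<lambda>\<theta>. ((1 - sph_t \<theta> (\<theta> * x) \<phi>) / \<theta>\<^sup>2) / ((1 - sph_t \<theta> (\<theta> * x) \<phi>) / (?a \<theta>)\<^sup>2) = (?a \<theta> / \<theta>)\<^sup>2) (at_right 0)"
    using ev
  proof eventually_elim
    fix \<theta> assume t: "\<theta> \<in> {0<..<?b}"
    have "cos (?a \<theta>) < cos 0" using pos[OF t] sph_a_bounds[of \<theta> "\<theta> * x" \<phi>] by (intro cos_monotone_0_pi) auto
    then have "1 - sph_t \<theta> (\<theta> * x) \<phi> \<noteq> 0" by simp
    then show "((1 - sph_t \<theta> (\<theta> * x) \<phi>) / \<theta>\<^sup>2) / ((1 - sph_t \<theta> (\<theta> * x) \<phi>) / (?a \<theta>)\<^sup>2) = (?a \<theta> / \<theta>)\<^sup>2"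
      using t by (simp add: power_divide)
  qed
  with lim show ?thesis by (rule Lim_transform_eventually)
qed

text \<open>Dominated convergence in the angle at a fixed radius: the triangle inequality gives
  \<open>a / \<theta> \<ge> \<bar>x - 1\<bar>\<close>, so the integrand is bounded by a constant
  depending on \<open>x\<close>.\<close>

lemma tendsto_scaled_H:
  assumes q: "0 < q" and x: "0 < x" "x \<noteq> 1"
  shows "((\<lambda>\<theta>. scaled_H q \<theta> x) \<longlongrightarrow> plane_H q x) (at_right 0)"
proof (rule tendsto_at_right_sequentially[of 0 "pi / (x + 1)"])
  fix S :: "nat \<Rightarrow> real"
  assume S: "\<And>n. 0 < S n" "\<And>n. S n < pi / (x + 1)" and S0: "S \<longlonglongrightarrow> 0"
  have filt: "filterlim S (at_right 0) sequentially"
    using S0 S(1) by (auto simp: filterlim_at less_imp_neq[symmetric])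
  show "(\<lambda>n. scaled_H q (S n) x) \<longlonglongrightarrow> plane_H q x"
    unfolding scaled_H_def plane_H_def set_lebesgue_integral_def
  proof (rule integral_dominated_convergence)
    show "integrable lborel (\<lambda>\<phi>. indicator {0..pi} \<phi> * (x powr (- q) + \<bar>x - 1\<bar> powr (- q)))"
      by simp
    show "(\<lambda>\<phi>. indicator {0..pi} \<phi> *\<^sub>R (x powr (- q) - (sph_a (S n) (S n * x) \<phi> / S n) powr (- q))) \<in> borel_measurable lborel" for n
    proof -
      have [measurable]: "(\<lambda>\<phi>. sph_a (S n) (S n * x) \<phi>) \<in> borel_measurable borel"
        by (intro borel_measurable_continuous_onI continuous_on_sph_a_snd)
      show ?thesis by measurable
    qed
    show "AE \<phi> in lborel. norm (indicator {0..pi} \<phi> *\<^sub>R (x powr (- q) - (sph_a (S n) (S n * x) \<phi> / S n) powr (- q)))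
       \<le> indicator {0..pi} \<phi> * (x powr (- q) + \<bar>x - 1\<bar> powr (- q))" for n
    proof (rule AE_I2)
      fix \<phi> :: real
      have "S n * (x + 1) < pi" using S(2)[of n] x by (simp add: field_simps)
      then have "S n * x \<le> pi" "S n \<le> pi" using S(1)[of n] x by (auto simp: distrib_left intro: order.trans[of _ "S n * x + S n"])
      then have "\<bar>S n * x - S n\<bar> \<le> sph_a (S n) (S n * x) \<phi>"
        using S(1)[of n] x by (intro abs_sph_a_minus_le(2)) auto
      also have "\<bar>S n * x - S n\<bar> = S n * \<bar>x - 1\<bar>"
        using S(1)[of n] abs_mult[of "S n" "x - 1"] by (simp add: algebra_simps)
      finally have "\<bar>x - 1\<bar> \<le> sph_a (S n) (S n * x) \<phi> / S n"
        using S(1)[of n] by (simp add: field_simps)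
      then have "(sph_a (S n) (S n * x) \<phi> / S n) powr (- q) \<le> \<bar>x - 1\<bar> powr (- q)"
        using q x by (intro powr_mono2') auto
      moreover have "\<bar>u - v\<bar> \<le> u + w" if "0 \<le> u" "0 \<le> v" "v \<le> w" for u v w :: real using that by auto
      ultimately show "norm (indicator {0..pi} \<phi> *\<^sub>R (x powr (- q) - (sph_a (S n) (S n * x) \<phi> / S n) powr (- q)))
       \<le> indicator {0..pi} \<phi> * (x powr (- q) + \<bar>x - 1\<bar> powr (- q))"
        by (simp add: indicator_def)
    qed
    show "AE \<phi> in lborel. (\<lambda>n. indicator {0..pi} \<phi> *\<^sub>R (x powr (- q) - (sph_a (S n) (S n * x) \<phi> / S n) powr (- q)))
      \<longlonglongrightarrow> indicator {0..pi} \<phi> *\<^sub>R (x powr (- q) - (x\<^sup>2 + 1 - 2 * x * cos \<phi>) powr (- q / 2))"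
    proof (rule AE_I2)
      fix \<phi> :: real
      have "0 < x\<^sup>2 + 1 - 2 * x * cos \<phi>" using x by (intro plane_dist_sq_pos) auto
      then have "(\<lambda>n. ((sph_a (S n) (S n * x) \<phi> / S n)\<^sup>2) powr (- q / 2)) \<longlonglongrightarrow> (x\<^sup>2 + 1 - 2 * x * cos \<phi>) powr (- q / 2)"
        using filterlim_compose[OF tendsto_sph_a_over[OF x] filt] by (intro tendsto_powr tendsto_const) auto
      also have "(\<lambda>n. ((sph_a (S n) (S n * x) \<phi> / S n)\<^sup>2) powr (- q / 2)) = (\<lambda>n. (sph_a (S n) (S n * x) \<phi> / S n) powr (- q))"
      proof
        fix n
        have "0 \<le> sph_a (S n) (S n * x) \<phi> / S n" using S(1)[of n] by (simp add: sph_a_bounds)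
        then have "(sph_a (S n) (S n * x) \<phi> / S n)\<^sup>2 = (sph_a (S n) (S n * x) \<phi> / S n) powr 2" by simp
        then show "((sph_a (S n) (S n * x) \<phi> / S n)\<^sup>2) powr (- q / 2) = (sph_a (S n) (S n * x) \<phi> / S n) powr (- q)"
          by (simp only: powr_powr) simp
      qed
      finally show "(\<lambda>n. indicator {0..pi} \<phi> *\<^sub>R (x powr (- q) - (sph_a (S n) (S n * x) \<phi> / S n) powr (- q)))
      \<longlonglongrightarrow> indicator {0..pi} \<phi> *\<^sub>R (x powr (- q) - (x\<^sup>2 + 1 - 2 * x * cos \<phi>) powr (- q / 2))"
        by (rule tendsto_scaleR[OF tendsto_const tendsto_diff[OF tendsto_const]])
    qed
  qed measurable
qed (use x in simp)

section \<open>The rescaled integrand and its dominating function\<close>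

lemma sph_H_measurable [measurable]: "sph_H q \<theta> \<in> borel_measurable borel"
proof -
  have "(\<lambda>p. sph_a \<theta> (fst p) (snd p)) \<in> borel_measurable (borel \<Otimes>\<^sub>M borel)"
    unfolding borel_prod by (rule sph_a_measurable)
  then have [measurable]: "(\<lambda>p. sph_a \<theta> (fst p) (snd p)) \<in> borel_measurable (borel \<Otimes>\<^sub>M lborel)"
    by (subst measurable_cong_sets[OF sets_pair_measure_cong[OF refl sets_lborel] refl])
  show ?thesis
    unfolding sph_H_def set_lebesgue_integral_def
    by (rule lborel.borel_measurable_lebesgue_integral) (simp add: split_beta')
qed

text \<open>The powers of \<open>\<theta>\<close> are distributed so that each factor converges on
  its own as \<open>\<theta>\<close> tends to 0: to \<open>x powr (- q)\<close>, to
  \<open>x\<close>, and to \<open>plane_H q x\<close> for \<open>x \<noteq> 1\<close>.\<close>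

definition scaled_integrand :: "real \<Rightarrow> real \<Rightarrow> real \<Rightarrow> real" where
  "scaled_integrand q \<theta> x = indicator {0<..pi / \<theta>} x *
     ((x powr (- q) - (\<theta> / pi) powr q) * (sin (\<theta> * x) / \<theta>) * scaled_H q \<theta> x)"

text \<open>By \<open>sph_a_ge_sin_sin\<close> and \<open>sin \<theta> \<ge> \<theta> / 4\<close>,
  the scaled distance is at least \<open>sin \<phi> / 4\<close>. The resulting bound is uniform in
  \<open>\<theta>\<close> and stays finite as \<open>x\<close> approaches 1.\<close>

lemma scaled_H_abs_le:
  assumes q: "0 < q" "q < 1" and th: "0 < \<theta>" "\<theta> \<le> 1" and x: "0 < x" "\<theta> * x \<le> pi" "x \<noteq> 1"
  shows "\<bar>scaled_H q \<theta> x\<bar> \<le> pi * x powr (- q) + 4 powr q * (LBINT \<phi>:{0..pi}. sin \<phi> powr (- q))"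
proof -
  have th2: "\<theta> \<le> pi" using th pi_gt3 by linarith
  have i1: "set_integrable lborel {0..pi} (\<lambda>\<phi>. x powr (- q))"
    by (intro borel_integrable_atLeastAtMost' continuous_intros)
  have i2: "set_integrable lborel {0..pi} (\<lambda>\<phi>. (sph_a \<theta> (\<theta> * x) \<phi> / \<theta>) powr (- q))"
  proof -
    have "set_integrable lborel {0..pi} (\<lambda>\<phi>. sph_a \<theta> (\<theta> * x) \<phi> powr (- q) / \<theta> powr (- q))"
      using th th2 x by (intro set_integrable_divide set_integrable_powr_sph_a) auto
    then show ?thesis by (simp add: powr_divide)
  qed
  have "(LBINT \<phi>:{0..pi}. (sph_a \<theta> (\<theta> * x) \<phi> / \<theta>) powr (- q)) \<le> (LBINT \<phi>:{0..pi}. 4 powr q * sin \<phi> powr (- q))"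
    unfolding set_lebesgue_integral_def
  proof (rule integral_mono_AE)
    show "AE \<phi> in lborel. indicator {0..pi} \<phi> *\<^sub>R (sph_a \<theta> (\<theta> * x) \<phi> / \<theta>) powr (- q) \<le> indicator {0..pi} \<phi> *\<^sub>R (4 powr q * sin \<phi> powr (- q))"
      using AE_lborel_singleton[of 0] AE_lborel_singleton[of pi]
    proof eventually_elim
      fix \<phi> :: real assume n: "\<phi> \<noteq> 0" "\<phi> \<noteq> pi"
      show "indicator {0..pi} \<phi> *\<^sub>R (sph_a \<theta> (\<theta> * x) \<phi> / \<theta>) powr (- q) \<le> indicator {0..pi} \<phi> *\<^sub>R (4 powr q * sin \<phi> powr (- q))"
      proof (cases "\<phi> \<in> {0..pi}")
        case True
        then have s: "0 < sin \<phi>" using n by (intro sin_gt_zero) auto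
        have "\<theta> / 4 * sin \<phi> \<le> sin \<theta> * sin \<phi>"
          using th pi_gt3 s by (intro mult_right_mono sin_ge_quarter) auto
        also have "\<dots> \<le> sph_a \<theta> (\<theta> * x) \<phi>" by (rule sph_a_ge_sin_sin)
        finally have "sin \<phi> / 4 \<le> sph_a \<theta> (\<theta> * x) \<phi> / \<theta>" using th by (simp add: field_simps)
        then have "(sph_a \<theta> (\<theta> * x) \<phi> / \<theta>) powr (- q) \<le> (sin \<phi> / 4) powr (- q)"
          using q s by (intro powr_mono2') auto
        also have "\<dots> = 4 powr q * sin \<phi> powr (- q)"
          using powr_minus_divide[of "4::real" q] by (simp add: powr_divide)
        finally show ?thesis using True by simp
      qed simp
    qed
  qed (use i2 set_integrable_mult_right[OF set_integrable_sin_powr[OF q], of "4 powr q"] in \<open>auto simp: set_integrable_def\<close>)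
  moreover have "0 \<le> (LBINT \<phi>:{0..pi}. (sph_a \<theta> (\<theta> * x) \<phi> / \<theta>) powr (- q))"
    unfolding set_lebesgue_integral_def by (auto intro!: integral_nonneg_AE)
  moreover have "scaled_H q \<theta> x = pi * x powr (- q) - (LBINT \<phi>:{0..pi}. (sph_a \<theta> (\<theta> * x) \<phi> / \<theta>) powr (- q))"
    unfolding scaled_H_def by (subst set_integral_diff(2)[OF i1 i2]) (simp add: set_lebesgue_integral_def)
  moreover have "0 \<le> pi * x powr (- q)" by simp
  ultimately show ?thesis unfolding abs_le_iff set_integral_mult_right by linarith
qed

text \<open>The first piece is integrable at 0 because \<open>q < 1\<close>, the second at infinity
  because \<open>q > 0\<close>. At the common point 2 the pieces add up, which only enlarges the
  bound.\<close>

definition dominating :: "real \<Rightarrow> real \<Rightarrow> real" where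
  "dominating q x =
     indicator {0..2} x * (pi * x powr (1 - 2 * q) + 4 powr q * (LBINT \<phi>:{0..pi}. sin \<phi> powr (- q)) * x powr (1 - q))
   + indicator {2..} x * (pi * (q + q * (q + 1) * 2 powr (q + 1)) * x powr (- 2 * q - 1))"

lemma integrable_dominating:
  assumes "0 < q" "q < 1"
  shows "integrable lborel (dominating q)"
proof -
  have "set_integrable lborel {2..} (\<lambda>x::real. x powr (- 2 * q - 1))"
    using has_integral_powr_to_inf[of "- 2 * q - 1" 2] assms
    by (intro set_integrable_of_has_integral) auto
  moreover have "set_integrable lborel {0..2} (\<lambda>x. x powr (1 - 2 * q))" "set_integrable lborel {0..2} (\<lambda>x. x powr (1 - q))"
    using assms by (intro set_integrable_powr_Icc_0; simp)+
  ultimately have "integrable lborel (\<lambda>x. indicator {2..} x * x powr (- 2 * q - 1))"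
    "integrable lborel (\<lambda>x. indicator {0..2} x * x powr (1 - 2 * q))" "integrable lborel (\<lambda>x. indicator {0..2} x * x powr (1 - q))"
    by (simp_all add: set_integrable_def)
  then have "integrable lborel (\<lambda>x. pi * (indicator {0..2} x * x powr (1 - 2 * q))
     + 4 powr q * (LBINT \<phi>:{0..pi}. sin \<phi> powr (- q)) * (indicator {0..2} x * x powr (1 - q))
     + pi * (q + q * (q + 1) * 2 powr (q + 1)) * (indicator {2..} x * x powr (- 2 * q - 1)))"
    by (intro Bochner_Integration.integrable_add integrable_mult_right)
  then show ?thesis
    by (rule Bochner_Integration.integrable_cong[THEN iffD1, rotated 2]) (simp_all add: dominating_def algebra_simps)
qed

lemma scaled_integrand_bound:
  assumes q: "0 < q" "q < 1" and th: "0 < \<theta>" "\<theta> \<le> 1" and x: "x \<noteq> 1"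
  shows "\<bar>scaled_integrand q \<theta> x\<bar> \<le> dominating q x"
proof (cases "0 < x \<and> x \<le> pi / \<theta>")
  case True
  then have x0: "0 < x" "\<theta> * x \<le> pi" using th by (auto simp: field_simps)
  let ?M = "LBINT \<phi>:{0..pi}. sin \<phi> powr (- q)"
  let ?K = "pi * (q + q * (q + 1) * 2 powr (q + 1))"
  have M: "0 \<le> ?M" unfolding set_lebesgue_integral_def by (auto intro!: integral_nonneg_AE)
  have K: "0 \<le> ?K" using q by simp
  \<comment> \<open>Since \<open>x \<le> pi / \<theta>\<close>, the subtracted constant is at most
    \<open>x powr (- q)\<close>, so the kernel factor lies between 0 and
    \<open>x powr (- q)\<close>.\<close>
  have "(\<theta> / pi) powr q = (pi / \<theta>) powr (- q)" by (simp add: powr_divide powr_minus field_simps)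
  also have "\<dots> \<le> x powr (- q)" using True q by (intro powr_mono2') auto
  finally have 1: "\<bar>x powr (- q) - (\<theta> / pi) powr q\<bar> \<le> x powr (- q)" by simp
  have s0: "0 \<le> sin (\<theta> * x)" using th x0 by (intro sin_ge_zero) auto
  have s1: "sin (\<theta> * x) / \<theta> \<le> x" using th x0 sin_x_le_x[of "\<theta> * x"] by (simp add: field_simps)
  have e: "\<bar>scaled_integrand q \<theta> x\<bar> = \<bar>x powr (- q) - (\<theta> / pi) powr q\<bar> * (sin (\<theta> * x) / \<theta> * \<bar>scaled_H q \<theta> x\<bar>)"
    using True s0 th by (simp add: scaled_integrand_def abs_mult)
  show ?thesis
  proof (cases "x \<le> 2")
    case le: True
    have "\<bar>scaled_integrand q \<theta> x\<bar> \<le> x powr (- q) * (x * (pi * x powr (- q) + 4 powr q * ?M))"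
      unfolding e using scaled_H_abs_le[OF q th x0 x] s1 s0 th x0 M
      by (intro mult_mono 1) auto
    also have "\<dots> = pi * (x * x powr (- q) * x powr (- q)) + 4 powr q * ?M * (x * x powr (- q))"
      by (simp add: algebra_simps)
    also have "x * x powr (- q) = x powr (1 - q)" using powr_mult_base[of x "- q"] x0 by simp
    also have "x powr (1 - q) * x powr (- q) = x powr (1 - 2 * q)" by (simp flip: powr_add)
    also have "pi * x powr (1 - 2 * q) + 4 powr q * ?M * x powr (1 - q) \<le> dominating q x"
      using x0 le K by (simp add: dominating_def indicator_def)
    finally show ?thesis .
  next
    case False
    have pith: "\<theta> \<le> pi" using th pi_gt3 by linarith
    have "scaled_H q \<theta> x = \<theta> powr q * sph_H q \<theta> (\<theta> * x)"
      using sph_H_scaled[of \<theta> x q] th x0 by (simp add: powr_minus field_simps)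
    then have "sin (\<theta> * x) / \<theta> * \<bar>scaled_H q \<theta> x\<bar> = \<theta> powr q / \<theta> * (\<bar>sph_H q \<theta> (\<theta> * x)\<bar> * sin (\<theta> * x))"
      by (simp add: abs_mult)
    also have "\<dots> \<le> \<theta> powr q / \<theta> * (?K * \<theta>\<^sup>2 * (\<theta> * x) powr (- q - 1))"
      using th x0 False pith q by (intro mult_left_mono sph_H_bound) auto
    \<comment> \<open>The exponents of \<open>\<theta>\<close> are \<open>q - 1\<close>,
      \<open>2\<close> and \<open>- q - 1\<close>, which sum to zero: the second-order bound is
      exactly scale invariant.\<close>
    also have "\<dots> = ?K * (\<theta> powr q * \<theta> * (\<theta> powr (- q - 1))) * x powr (- q - 1)"
      using th by (simp add: powr_mult power2_eq_square mult_ac)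
    also have "\<theta> powr q * \<theta> = \<theta> powr (q + 1)" using th by (simp add: powr_add)
    also have "\<theta> powr (q + 1) * \<theta> powr (- q - 1) = 1" using th by (simp flip: powr_add)
    finally have 2: "sin (\<theta> * x) / \<theta> * \<bar>scaled_H q \<theta> x\<bar> \<le> ?K * x powr (- q - 1)" by simp
    have "\<bar>scaled_integrand q \<theta> x\<bar> \<le> x powr (- q) * (?K * x powr (- q - 1))"
      unfolding e using s0 th by (intro mult_mono 1 2) auto
    also have "\<dots> = ?K * (x powr (- q) * x powr (- q - 1))" by (simp only: mult_ac)
    also have "x powr (- q) * x powr (- q - 1) = x powr (- 2 * q - 1)" by (simp flip: powr_add)
    also have "?K * x powr (- 2 * q - 1) \<le> dominating q x"
      using False by (simp add: dominating_def indicator_def)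
    finally show ?thesis .
  qed
next
  case False
  have "0 \<le> (LBINT \<phi>:{0..pi}. sin \<phi> powr (- q))" unfolding set_lebesgue_integral_def by (auto intro!: integral_nonneg_AE)
  then show ?thesis using False q by (auto simp: scaled_integrand_def dominating_def indicator_def)
qed

text \<open>In the exponent \<open>2 * q - 1\<close>, one \<open>q\<close> comes from the kernel,
  one from \<open>sph_H\<close>, and the -1 from the sine divided by
  \<open>\<theta>\<close>.\<close>

lemma scaled_integrand_eq:
  assumes "0 < \<theta>"
  shows "scaled_integrand q \<theta> x = \<theta> powr (2 * q - 1) *
    (indicator {0<..pi} (\<theta> * x) * (((\<theta> * x) powr (- q) - pi powr (- q)) * sin (\<theta> * x) * sph_H q \<theta> (\<theta> * x)))"
proof (cases "0 < x")
  case True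
  have "indicator {0<..pi / \<theta>} x = (indicator {0<..pi} (\<theta> * x) :: real)"
    using assms True by (auto simp: indicator_def field_simps)
  moreover have "x powr (- q) - (\<theta> / pi) powr q = \<theta> powr q * ((\<theta> * x) powr (- q) - pi powr (- q))"
    using assms True by (simp add: powr_mult powr_divide powr_minus field_simps)
  moreover have "scaled_H q \<theta> x = \<theta> powr q * sph_H q \<theta> (\<theta> * x)"
    using sph_H_scaled[of \<theta> x q] assms True by (simp add: powr_minus field_simps)
  moreover have "\<theta> powr (2 * q - 1) = \<theta> powr q * \<theta> powr q / \<theta>"
    using assms by (simp add: powr_diff flip: powr_add)
  ultimately show ?thesis unfolding scaled_integrand_def by simp
qed (use assms in \<open>simp add: scaled_integrand_def indicator_def zero_less_mult_iff\<close>)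

lemma scaled_integrand_measurable:
  assumes "0 < \<theta>"
  shows "scaled_integrand q \<theta> \<in> borel_measurable borel"
  unfolding scaled_integrand_eq[OF assms, abs_def] by measurable

lemma integrable_scaled_integrand:
  assumes "0 < q" "q < 1" "0 < \<theta>" "\<theta> \<le> 1"
  shows "integrable lborel (scaled_integrand q \<theta>)"
proof (rule Bochner_Integration.integrable_bound[OF integrable_dominating[OF assms(1,2)]])
  show "AE x in lborel. norm (scaled_integrand q \<theta> x) \<le> norm (dominating q x)"
    using AE_lborel_singleton[of 1]
    by eventually_elim (use scaled_integrand_bound[OF assms] in \<open>force\<close>)
qed (use scaled_integrand_measurable[OF assms(3)] in simp)

lemma tendsto_scaled_integrand:
  assumes q: "0 < q" and x: "x \<noteq> 1"
  shows "((\<lambda>\<theta>. scaled_integrand q \<theta> x) \<longlongrightarrow> indicator {0<..} x * (x powr (1 - q) * plane_H q x)) (at_right 0)"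
proof (cases "0 < x")
  case True
  have "((\<lambda>\<theta>. (x powr (- q) - (\<theta> / pi) powr q) * (sin (\<theta> * x) / \<theta>) * scaled_H q \<theta> x) \<longlongrightarrow> (x powr (- q) - 0) * x * plane_H q x) (at_right 0)"
  proof (intro tendsto_mult tendsto_diff tendsto_const tendsto_scaled_H q True x)
    show "((\<lambda>\<theta>. (\<theta> / pi) powr q) \<longlongrightarrow> 0) (at_right 0)" using q by real_asymp
    show "((\<lambda>\<theta>. sin (\<theta> * x) / \<theta>) \<longlongrightarrow> x) (at_right 0)" by real_asymp
  qed
  also have "(x powr (- q) - 0) * x * plane_H q x = indicator {0<..} x * (x powr (1 - q) * plane_H q x)"
    using True powr_mult_base[of x "- q"] by (simp add: mult.commute)
  finally show ?thesis
  proof (rule Lim_transform_eventually)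
    have "eventually (\<lambda>\<theta>. \<theta> \<in> {0<..<pi / x}) (at_right (0::real))"
      using True by (intro eventually_at_right_real) auto
    then show "eventually (\<lambda>\<theta>. (x powr (- q) - (\<theta> / pi) powr q) * (sin (\<theta> * x) / \<theta>) * scaled_H q \<theta> x = scaled_integrand q \<theta> x) (at_right 0)"
    proof eventually_elim
      fix \<theta> assume "\<theta> \<in> {0<..<pi / x}"
      then have "x \<in> {0<..pi / \<theta>}" using True by (auto simp: field_simps)
      then show "(x powr (- q) - (\<theta> / pi) powr q) * (sin (\<theta> * x) / \<theta>) * scaled_H q \<theta> x = scaled_integrand q \<theta> x"
        by (simp add: scaled_integrand_def)
    qed
  qed
qed (simp add: scaled_integrand_def[abs_def])

text \<open>Dominated convergence along arbitrary sequences gives the limit. The integrability of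
  the limit function is recorded as well, since \<open>LBINT_plane_H\<close> requires it.\<close>

lemma LBINT_scaled_integrand_tendsto:
  assumes q: "0 < q" "q < 1"
  shows "integrable lborel (\<lambda>x. indicator {0<..} x * (x powr (1 - q) * plane_H q x))" (is "integrable _ ?f")
    and "((\<lambda>\<theta>. \<integral>x. scaled_integrand q \<theta> x \<partial>lborel) \<longlongrightarrow> (\<integral>x. indicator {0<..} x * (x powr (1 - q) * plane_H q x) \<partial>lborel)) (at_right 0)"
proof -
  have dct: "integrable lborel ?f \<and> (\<lambda>n. \<integral>x. scaled_integrand q (S n) x \<partial>lborel) \<longlonglongrightarrow> (\<integral>x. ?f x \<partial>lborel)"
    if S: "\<And>n. 0 < S n" "\<And>n. S n < 1" "S \<longlonglongrightarrow> 0" for S :: "nat \<Rightarrow> real"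
  proof -
    have filt: "filterlim S (at_right 0) sequentially"
      using S(1,3) by (auto simp: filterlim_at less_imp_neq[symmetric])
    have 1: "?f \<in> borel_measurable lborel" by measurable
    have 2: "scaled_integrand q (S n) \<in> borel_measurable lborel" for n
      using scaled_integrand_measurable[OF S(1)] by simp
    have 3: "AE x in lborel. (\<lambda>n. scaled_integrand q (S n) x) \<longlonglongrightarrow> ?f x"
      using AE_lborel_singleton[of 1]
      by eventually_elim (rule filterlim_compose[OF tendsto_scaled_integrand[OF q(1)] filt])
    have 4: "AE x in lborel. norm (scaled_integrand q (S n) x) \<le> dominating q x" for n
      using AE_lborel_singleton[of 1]
      by eventually_elim (use scaled_integrand_bound[OF q S(1) less_imp_le[OF S(2)]] in simp)
    show ?thesis
      using integrable_dominated_convergence[OF 1 2 integrable_dominating[OF q] 3 4]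
        integral_dominated_convergence[OF 1 2 integrable_dominating[OF q] 3 4] by blast
  qed
  \<comment> \<open>The shift by two keeps all members of this sample sequence strictly below
    1.\<close>
  have "(\<lambda>n. inverse (real (Suc (Suc n)))) \<longlonglongrightarrow> 0"
    by real_asymp
  then show "integrable lborel ?f" using dct[of "\<lambda>n. inverse (real (Suc (Suc n)))"] by (auto simp: inverse_less_1_iff)
  show "((\<lambda>\<theta>. \<integral>x. scaled_integrand q \<theta> x \<partial>lborel) \<longlongrightarrow> (\<integral>x. ?f x \<partial>lborel)) (at_right 0)"
    by (rule tendsto_at_right_sequentially[of 0 1]) (use dct in auto)
qed

subsection \<open>The correlation function\<close>

lemma sph_A_eq:
  assumes "0 \<le> \<theta>" "\<theta> \<le> pi" "0 \<le> l" "l \<le> pi" "l \<noteq> \<theta>"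
  shows "sph_A \<theta> l = {0..pi}"
proof -
  have "0 < sph_a \<theta> l \<phi>" for \<phi>
    using abs_sph_a_minus_le(2)[OF assms(1-4), of \<phi>] assms(5) by linarith
  then show ?thesis using sph_a_bounds by (auto simp: sph_A_def)
qed

lemma sph_A_kernel_integral:
  assumes "0 \<le> \<theta>" "\<theta> \<le> pi" "0 \<le> l" "l \<le> pi" "l \<noteq> \<theta>"
  shows "(LBINT \<phi>:sph_A \<theta> l. (pi powr q * sph_a \<theta> l \<phi> powr (- q) - 1))
    = pi * (pi powr q * l powr (- q) - 1) - pi powr q * sph_H q \<theta> l"
proof -
  have i0: "set_integrable lborel {0..pi} (\<lambda>\<phi>. c)" for c :: real
    by (intro borel_integrable_atLeastAtMost' continuous_intros)
  note i1 = set_integrable_powr_sph_a[OF assms, of "- q"]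
  have 1: "(LBINT \<phi>:{0..pi}. sph_a \<theta> l \<phi> powr (- q)) = pi * l powr (- q) - sph_H q \<theta> l"
    unfolding sph_H_def by (subst set_integral_diff(2)[OF i0 i1]) (simp add: set_lebesgue_integral_def)
  have 2: "(LBINT \<phi>:{0..pi}. (pi powr q * sph_a \<theta> l \<phi> powr (- q) - 1))
    = pi powr q * (LBINT \<phi>:{0..pi}. sph_a \<theta> l \<phi> powr (- q)) - pi"
    by (subst set_integral_diff(2)[OF set_integrable_mult_right[OF i1] i0]) (simp add: set_lebesgue_integral_def)
  show ?thesis unfolding sph_A_eq[OF assms] 2 1 by (simp add: algebra_simps)
qed

lemma sph_H_0: "0 \<le> l \<Longrightarrow> l \<le> pi \<Longrightarrow> sph_H q 0 l = 0"
  unfolding sph_H_def sph_a_def sph_t_def by (simp add: arccos_cos set_lebesgue_integral_def)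

text \<open>With \<open>sin l \<le> l\<close> the integrand is at most a multiple of
  \<open>l powr (1 - 2 * q)\<close>. Integrability allows \<open>C 0\<close> to be split off from
  \<open>C \<theta>\<close> as a separate finite integral.\<close>

lemma kernel_sq_integrable:
  assumes q: "0 < q" "q < 1"
  shows "set_integrable lborel {0..pi} (\<lambda>l. (pi powr q * l powr (- q) - 1)\<^sup>2 * sin l)"
  unfolding set_integrable_def
proof (rule Bochner_Integration.integrable_bound)
  have "set_integrable lborel {0..pi} (\<lambda>l. l powr (1 - 2 * q))"
    using q by (intro set_integrable_powr_Icc_0) auto
  then show "integrable lborel (\<lambda>l. pi powr (2 * q) * (indicator {0..pi} l * l powr (1 - 2 * q)))"
    unfolding set_integrable_def by simp
  show "AE l in lborel. norm (indicator {0..pi} l *\<^sub>R ((pi powr q * l powr (- q) - 1)\<^sup>2 * sin l))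
     \<le> norm (pi powr (2 * q) * (indicator {0..pi} l * l powr (1 - 2 * q)))"
  proof (rule AE_I2)
    fix l :: real
    consider "0 < l" "l \<le> pi" | "l = 0" | "l \<notin> {0..pi}" by fastforce
    then show "norm (indicator {0..pi} l *\<^sub>R ((pi powr q * l powr (- q) - 1)\<^sup>2 * sin l))
     \<le> norm (pi powr (2 * q) * (indicator {0..pi} l * l powr (1 - 2 * q)))"
    proof cases
      case 1
      have "pi powr (- q) \<le> l powr (- q)" using 1 q by (intro powr_mono2') auto
      then have "pi powr q * pi powr (- q) \<le> pi powr q * l powr (- q)" by (intro mult_left_mono) auto
      then have k: "0 \<le> pi powr q * l powr (- q) - 1" by (simp flip: powr_add)
      have s: "0 \<le> sin l" "sin l \<le> l" using 1 by (auto intro: sin_ge_zero sin_x_le_x)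
      have "(pi powr q * l powr (- q) - 1)\<^sup>2 * sin l \<le> (pi powr q * l powr (- q))\<^sup>2 * l"
        using k s 1 by (intro mult_mono power_mono) auto
      also have "\<dots> = (pi powr q * pi powr q) * (l powr (- q) * (l * l powr (- q)))"
        by (simp add: power2_eq_square mult_ac)
      also have "\<dots> = pi powr (2 * q) * l powr (1 - 2 * q)"
        using 1 powr_mult_base[of l "- q"] by (simp flip: powr_add)
      finally show ?thesis using 1 k s by (simp add: abs_mult)
    qed auto
  qed
qed simp

text \<open>The integrand is positive on the open interval, which has positive measure. Positivity
  of \<open>c2\<close> is what makes the limit constant positive, as a fractal index
  demands.\<close>

lemma c2_pos:
  assumes q: "0 < q" "q < 1"
  shows "0 < c2 q"
proof -
  let ?f = "\<lambda>l. indicator {0..pi} l *\<^sub>R ((pi powr q * l powr (- q) - 1)\<^sup>2 * sin l)"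
  have int: "integrable lborel ?f" using kernel_sq_integrable[OF q] by (simp add: set_integrable_def)
  have nn: "0 \<le> ?f l" for l by (auto simp: indicator_def sin_ge_zero)
  have pos: "0 < ?f l" if l: "l \<in> {0<..<pi}" for l
  proof -
    have "pi powr (- q) < l powr (- q)" using l q by (intro powr_less_mono2_neg) auto
    then have "pi powr q * pi powr (- q) < pi powr q * l powr (- q)" by (intro mult_strict_left_mono) auto
    then have "0 < pi powr q * l powr (- q) - 1" by (simp flip: powr_add)
    moreover have "0 < sin l" using l by (intro sin_gt_zero) auto
    ultimately show ?thesis using l by simp
  qed
  have "integral\<^sup>L lborel ?f \<noteq> 0"
  proof
    assume "integral\<^sup>L lborel ?f = 0"
    then have "AE l in lborel. ?f l = 0"
      using integral_nonneg_eq_0_iff_AE[OF int] nn by auto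
    then have "AE l in lborel. l \<notin> {0<..<pi}" by eventually_elim (use pos in force)
    moreover have "{l \<in> space lborel. \<not> l \<notin> {0<..<pi}} = {0<..<pi}" by auto
    ultimately have "emeasure lborel {0<..<pi} = 0"
      using AE_iff_measurable[of "{0<..<pi}" lborel "\<lambda>l. l \<notin> {0<..<pi}"] by simp
    moreover have "emeasure lborel {0<..<pi} = ennreal (pi - 0)"
      by (rule emeasure_lborel_Ioo) simp
    ultimately show False by simp
  qed
  moreover have "0 \<le> integral\<^sup>L lborel ?f" using nn by (intro integral_nonneg_AE) auto
  ultimately have "0 < integral\<^sup>L lborel ?f" by simp
  then show ?thesis by (simp add: c2_def set_lebesgue_integral_def)
qed

text \<open>For small \<open>\<theta>\<close>, \<open>C 0 - C \<theta>\<close> is the integral of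
  this function times \<open>2 * pi powr (2 * q) / c2 q\<close>.\<close>

definition defect :: "real \<Rightarrow> real \<Rightarrow> real \<Rightarrow> real" where
  "defect q \<theta> l = indicator {0<..pi} l * ((l powr (- q) - pi powr (- q)) * sin l * sph_H q \<theta> l)"

lemma defect_measurable [measurable]: "defect q \<theta> \<in> borel_measurable borel"
  unfolding defect_def by measurable

text \<open>The form \<open>0 + \<theta> * x\<close> matches the affine substitution rules for
  \<open>lborel\<close>.\<close>

lemma defect_scaled: "0 < \<theta> \<Longrightarrow> defect q \<theta> (0 + \<theta> * x) = \<theta> powr (1 - 2 * q) * scaled_integrand q \<theta> x"
  unfolding scaled_integrand_eq defect_def by (simp flip: powr_add mult.assoc)

lemma defect_integrable:
  assumes "0 < q" "q < 1" "0 < \<theta>" "\<theta> \<le> 1"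
  shows "integrable lborel (defect q \<theta>)"
proof -
  have "integrable lborel (\<lambda>x. defect q \<theta> (0 + \<theta> * x))"
    unfolding defect_scaled[OF assms(3)] by (intro integrable_mult_right integrable_scaled_integrand assms)
  then show ?thesis using assms(3) by (subst (asm) lborel_integrable_real_affine_iff) auto
qed

lemma integral_defect:
  assumes "0 < \<theta>"
  shows "(\<integral>l. defect q \<theta> l \<partial>lborel) = \<theta> powr (2 - 2 * q) * (\<integral>x. scaled_integrand q \<theta> x \<partial>lborel)"
proof -
  have "(\<integral>l. defect q \<theta> l \<partial>lborel) = \<theta> * (\<integral>x. defect q \<theta> (0 + \<theta> * x) \<partial>lborel)"
    using assms by (subst lborel_integral_real_affine[where c = \<theta> and t = 0]) auto
  also have "\<dots> = (\<theta> * \<theta> powr (1 - 2 * q)) * (\<integral>x. scaled_integrand q \<theta> x \<partial>lborel)"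
    unfolding defect_scaled[OF assms] by simp
  also have "\<theta> * \<theta> powr (1 - 2 * q) = \<theta> powr (2 - 2 * q)"
    using assms powr_mult_base[of \<theta> "1 - 2 * q"] by simp
  finally show ?thesis .
qed

lemma correlation_integral:
  assumes q: "0 < q" "q < 1" and th: "0 \<le> \<theta>" "\<theta> \<le> pi"
  shows "(LBINT l:{0..pi}. (pi powr q * l powr (- q) - 1) * sin l *
          (LBINT \<phi>:sph_A \<theta> l. (pi powr q * sph_a \<theta> l \<phi> powr (- q) - 1)))
    = (\<integral>l. pi * (indicator {0..pi} l *\<^sub>R ((pi powr q * l powr (- q) - 1)\<^sup>2 * sin l)) - pi powr (2 * q) * defect q \<theta> l \<partial>lborel)"
  unfolding set_lebesgue_integral_def[of lborel "{0..pi}"]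
\<comment> \<open>At \<open>l = \<theta>\<close> the set \<open>sph_A\<close> is not the whole
  interval, since \<open>\<phi> = 0\<close> gives distance 0; at \<open>l = 0\<close> the power
  takes its default value. Both points are negligible.\<close>
proof (rule integral_discrete_difference[of "{0, \<theta>}"])
  fix l assume "l \<in> space lborel" "l \<notin> {0, \<theta>}"
  then have l: "l \<noteq> 0" "l \<noteq> \<theta>" by auto
  show "indicator {0..pi} l *\<^sub>R ((pi powr q * l powr (- q) - 1) * sin l *
          (LBINT \<phi>:sph_A \<theta> l. (pi powr q * sph_a \<theta> l \<phi> powr (- q) - 1)))
     = pi * (indicator {0..pi} l *\<^sub>R ((pi powr q * l powr (- q) - 1)\<^sup>2 * sin l)) - pi powr (2 * q) * defect q \<theta> l"
  proof (cases "0 \<le> l \<and> l \<le> pi")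
    case True
    \<comment> \<open>The kernel vanishes at pi; this factorisation yields one
      \<open>pi powr q\<close>, and the inner kernel integral yields the other one in
      \<open>pi powr (2 * q)\<close>.\<close>
    have e: "pi powr q * l powr (- q) - 1 = pi powr q * (l powr (- q) - pi powr (- q))"
      by (simp add: right_diff_distrib flip: powr_add)
    have d: "pi powr (2 * q) * defect q \<theta> l = pi powr q * pi powr q * ((l powr (- q) - pi powr (- q)) * sin l * sph_H q \<theta> l)"
      using True l by (simp add: defect_def flip: powr_add)
    have inner: "(LBINT \<phi>:sph_A \<theta> l. (pi powr q * sph_a \<theta> l \<phi> powr (- q) - 1))
      = pi * (pi powr q * l powr (- q) - 1) - pi powr q * sph_H q \<theta> l"
      using True l th by (intro sph_A_kernel_integral) auto
    show ?thesis
      using True unfolding inner d unfolding e by (simp add: power2_eq_square algebra_simps)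
  qed (simp add: defect_def indicator_def)
qed auto

theorem theorem4p1:
  fixes q :: real and C :: "real \<Rightarrow> real"
  assumes "0 < q" and "q < 1"
    and "\<And>\<theta>. 0 \<le> \<theta> \<Longrightarrow> \<theta> \<le> pi \<Longrightarrow>
      C \<theta> = 2 / c2 q *
        (LBINT l:{0..pi}. (pi powr q * l powr (- q) - 1) * sin l *
          (LBINT \<phi>:sph_A \<theta> l. (pi powr q * sph_a \<theta> l \<phi> powr (- q) - 1)))"
  shows "((\<lambda>\<theta>. (C 0 - C \<theta>) / \<theta> powr (2 - 2 * q)) \<longlongrightarrow> b_const q) (at_right 0)
    \<and> b_const q = pi powr (2 * q + 1) / (c2 q * (1 - q)\<^sup>2) *
        ((Gamma (1 - q / 2))\<^sup>2 * Gamma q / ((Gamma (q / 2))\<^sup>2 * Gamma (1 - q)))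
    \<and> has_fractal_index C (2 - 2 * q)"
proof -
  note q = assms(1,2)
  let ?J = "\<integral>x. indicator {0<..} x * (x powr (1 - q) * plane_H q x) \<partial>lborel"
  let ?F = "\<lambda>l. pi * (indicator {0..pi} l *\<^sub>R ((pi powr q * l powr (- q) - 1)\<^sup>2 * sin l))"
  have b: "b_const q = 2 * pi powr (2 * q) / c2 q * ?J"
  proof -
    \<comment> \<open>The two domains differ by the point 0, where \<open>0 powr (1 - q)\<close> is
      0.\<close>
    have "(LBINT x:{0..}. x powr (1 - q) * plane_H q x) = ?J"
      unfolding set_lebesgue_integral_def
      by (intro Bochner_Integration.integral_cong) (auto simp: indicator_def)
    then show ?thesis unfolding b_const_def plane_H_def by simp
  qed
  have diff: "C 0 - C \<theta> = 2 * pi powr (2 * q) / c2 q * (\<theta> powr (2 - 2 * q) * (\<integral>x. scaled_integrand q \<theta> x \<partial>lborel))"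
    if th: "0 < \<theta>" "\<theta> \<le> 1" for \<theta>
  proof -
    have intF: "integrable lborel ?F"
      using kernel_sq_integrable[OF q] by (simp add: set_integrable_def)
    \<comment> \<open>For \<open>\<theta> = 0\<close> one point is the pole itself, so
      \<open>a = l\<close> at every angle.\<close>
    have "defect q 0 l = 0" for l by (auto simp: defect_def indicator_def sph_H_0)
    then have "C 0 = 2 / c2 q * integral\<^sup>L lborel ?F"
      using assms(3)[of 0] correlation_integral[OF q, of 0] by simp
    moreover have "C \<theta> = 2 / c2 q * (integral\<^sup>L lborel ?F - pi powr (2 * q) * (\<integral>l. defect q \<theta> l \<partial>lborel))"
      using assms(3)[of \<theta>] correlation_integral[OF q, of \<theta>] th pi_gt3 intF defect_integrable[OF q th] by simp
    ultimately have "C 0 - C \<theta> = 2 * pi powr (2 * q) / c2 q * (\<integral>l. defect q \<theta> l \<partial>lborel)"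
      by (simp add: algebra_simps)
    then show ?thesis unfolding integral_defect[OF th(1)] .
  qed
  have lim: "((\<lambda>\<theta>. (C 0 - C \<theta>) / \<theta> powr (2 - 2 * q)) \<longlongrightarrow> b_const q) (at_right 0)"
  proof (rule Lim_transform_eventually)
    show "((\<lambda>\<theta>. 2 * pi powr (2 * q) / c2 q * (\<integral>x. scaled_integrand q \<theta> x \<partial>lborel)) \<longlongrightarrow> b_const q) (at_right 0)"
      unfolding b by (intro tendsto_mult tendsto_const LBINT_scaled_integrand_tendsto q)
    have "eventually (\<lambda>\<theta>. \<theta> \<in> {0<..<1}) (at_right (0::real))"
      by (intro eventually_at_right_real) auto
    then show "eventually (\<lambda>\<theta>. 2 * pi powr (2 * q) / c2 q * (\<integral>x. scaled_integrand q \<theta> x \<partial>lborel) = (C 0 - C \<theta>) / \<theta> powr (2 - 2 * q)) (at_right 0)"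
      by eventually_elim (simp add: diff)
  qed
  have val: "b_const q = pi powr (2 * q + 1) / (c2 q * (1 - q)\<^sup>2) *
        ((Gamma (1 - q / 2))\<^sup>2 * Gamma q / ((Gamma (q / 2))\<^sup>2 * Gamma (1 - q)))"
    unfolding b LBINT_plane_H[OF q LBINT_scaled_integrand_tendsto(1)[OF q]]
    by (simp add: powr_add)
  have "0 < b_const q"
    unfolding val using q c2_pos[OF q] by (intro mult_pos_pos divide_pos_pos zero_less_power Gamma_real_pos) auto
  with lim val q show ?thesis by (auto simp: has_fractal_index_def)
qed

end
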